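(* Let $M$ be a closed surface with a triangulation $\mathcal{T}=(V,E,F)$, $V=\{v_1,\dots,v_N\}$, and let $\Phi:E\to[0,\pi)$ be a weight satisfying condition $\langle\star\rangle$. Let $p>1$. For any initial hyperbolic circle packing metric $r(0)\in\mathbb{R}_{>0}^N$, the solution $u(t)$ (with $u_i=\ln\tanh(r_i/2)$) of the combinatorial $p$-th Calabi flow $$u_i'(t)=\sum_{v_j\sim v_i}B_{ij}\,|K_j-K_i|^{p-2}(K_j-K_i)-A_iK_i,\quad i=1,\dots,N,$$ exists for all time $t\in[0,+\infty)$. In particular (case $p=2$) the solution of the combinatorial Calabi flow $u_i'(t)=\sum_{v_j\sim v_i}B_{ij}(K_j-K_i)-A_iK_i$ exists for all time.
   Context: $\Phi_{ij}=\Phi(e_{ij})$, $I_{ij}=\cos\Phi_{ij}$; condition $\langle\star\rangle$: for every face $\triangle_{ijk}\in F$, $I_{ij}+I_{ik}I_{jk}\ge0$, $I_{ik}+I_{ij}I_{jk}\ge0$, $I_{jk}+I_{ij}I_{ik}\ge0$. A circle packing metric is $r:V\to(0,\infty)$; edge lengths are $l_{ij}=\cosh^{-1}(\cosh r_i\cosh r_j+\sinh r_i\sinh r_j\cos\Phi_{ij})$ and each face is realized as a hyperbolic triangle with these side lengths, with inner angle $\theta_i^{jk}$ at $v_i$. The discrete Gaussian curvature is $K_i=2\pi-\sum_{\triangle_{ijk}\in F}\theta_i^{jk}$ (sum over faces containing $v_i$). With $u_i=\ln\tanh(r_i/2)$, all quantities are functions of $u\in\mathbb{R}^N_{<0}$.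 $v_j\sim v_i$ means $v_i,v_j$ are joined by an edge. For an edge $e_{ij}$ with adjacent faces $\triangle_{ijk},\triangle_{ijl}$, $B_{ij}=\frac{\partial\theta_i^{jk}}{\partial u_j}+\frac{\partial\theta_i^{jl}}{\partial u_j}$, and $A_i=\frac{\partial}{\partial u_i}\big(\sum_{\triangle_{ijk}\in F}\mathrm{Area}(\triangle_{ijk})\big)$ (sum over faces containing $v_i$). *)

theory Defs
  imports "HOL-Analysis.Analysis"
begin

text \<open>Combinatorial setting. Vertices are the elements of a finite type 'v
(so V = UNIV and N = CARD('v)); a triangulation is given by its set F of
faces, each face being a 3-element set of vertices. Edges are the
2-element subsets of faces.\<close>

definition edges :: "'v set set \<Rightarrow> 'v set set" where
  "edges F = {e. card e = 2 \<and> (\<exists>f\<in>F. e \<subseteq> f)}"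

definition adjacent :: "'v set set \<Rightarrow> 'v \<Rightarrow> 'v \<Rightarrow> bool" where
  "adjacent F i j \<longleftrightarrow> {i, j} \<in> edges F"

definition link_adj :: "'v set set \<Rightarrow> 'v \<Rightarrow> 'v \<Rightarrow> 'v \<Rightarrow> bool" where
  "link_adj F v a b \<longleftrightarrow> a \<noteq> b \<and> {v, a, b} \<in> F"

text \<open>A triangulation of a closed (connected) surface: every face is a
triangle, every vertex lies on a face, every edge lies in exactly two faces,
the link of every vertex is connected (hence, with the previous condition,
a single cycle), and the 1-skeleton is connected.\<close>
definition closed_surface_triangulation :: "'v::finite set set \<Rightarrow> bool" where
  "closed_surface_triangulation F \<longleftrightarrow>
     (\<forall>f\<in>F. card f = 3) \<and>
     (\<forall>v. \<exists>f\<in>F. v \<in> f) \<and>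
     (\<forall>e\<in>edges F. card {f\<in>F. e \<subseteq> f} = 2) \<and>
     (\<forall>v a b. adjacent F v a \<and> adjacent F v b \<longrightarrow> (link_adj F v)\<^sup>*\<^sup>* a b) \<and>
     (\<forall>a b. (adjacent F)\<^sup>*\<^sup>* a b)"

definition weight :: "'v set set \<Rightarrow> ('v \<Rightarrow> 'v \<Rightarrow> real) \<Rightarrow> bool" where
  "weight F \<Phi> \<longleftrightarrow> (\<forall>i j. adjacent F i j \<longrightarrow> \<Phi> i j = \<Phi> j i \<and> 0 \<le> \<Phi> i j \<and> \<Phi> i j < pi)"

definition star_condition :: "'v set set \<Rightarrow> ('v \<Rightarrow> 'v \<Rightarrow> real) \<Rightarrow> bool" where
  "star_condition F \<Phi> \<longleftrightarrow>
     (\<forall>i j k. {i, j, k} \<in> F \<longrightarrow>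
        (let I = (\<lambda>a b. cos (\<Phi> a b)) in
          I i j + I i k * I j k \<ge> 0 \<and> I i k + I i j * I j k \<ge> 0 \<and> I j k + I i j * I i k \<ge> 0))"

text \<open>Radius from the coordinate u = ln tanh(r/2), i.e. r = 2 artanh(e^u).\<close>
definition radius :: "real \<Rightarrow> real" where
  "radius x = 2 * artanh (exp x)"

definition elen :: "('v \<Rightarrow> 'v \<Rightarrow> real) \<Rightarrow> ('v \<Rightarrow> real) \<Rightarrow> 'v \<Rightarrow> 'v \<Rightarrow> real" where
  "elen \<Phi> u i j = arcosh (cosh (radius (u i)) * cosh (radius (u j))
                  + sinh (radius (u i)) * sinh (radius (u j)) * cos (\<Phi> i j))"

text \<open>Inner angle at v_i of the hyperbolic triangle with side lengths
l_ij, l_ik, l_jk (hyperbolic law of cosines).\<close>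
definition angle :: "('v \<Rightarrow> 'v \<Rightarrow> real) \<Rightarrow> ('v \<Rightarrow> real) \<Rightarrow> 'v \<Rightarrow> 'v \<Rightarrow> 'v \<Rightarrow> real" where
  "angle \<Phi> u i j k =
     arccos ((cosh (elen \<Phi> u i j) * cosh (elen \<Phi> u i k) - cosh (elen \<Phi> u j k))
             / (sinh (elen \<Phi> u i j) * sinh (elen \<Phi> u i k)))"

text \<open>Inner angle at vertex i of face f (i \<in> f): theta_i^{jk} where f = {i,j,k}.
The value is symmetric in j,k, so the choice below is immaterial.\<close>
definition corner_angle :: "('v \<Rightarrow> 'v \<Rightarrow> real) \<Rightarrow> ('v \<Rightarrow> real) \<Rightarrow> 'v \<Rightarrow> 'v set \<Rightarrow> real" where
  "corner_angle \<Phi> u i f =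
     (let j = (SOME j. j \<in> f - {i}); k = (SOME k. k \<in> f - {i, j}) in angle \<Phi> u i j k)"

definition curvature :: "'v set set \<Rightarrow> ('v \<Rightarrow> 'v \<Rightarrow> real) \<Rightarrow> ('v \<Rightarrow> real) \<Rightarrow> 'v \<Rightarrow> real" where
  "curvature F \<Phi> u i = 2 * pi - (\<Sum>f\<in>{f\<in>F. i \<in> f}. corner_angle \<Phi> u i f)"

definition face_area :: "('v \<Rightarrow> 'v \<Rightarrow> real) \<Rightarrow> ('v \<Rightarrow> real) \<Rightarrow> 'v set \<Rightarrow> real" where
  "face_area \<Phi> u f = pi - (\<Sum>i\<in>f. corner_angle \<Phi> u i f)"

definition Bcoef :: "'v set set \<Rightarrow> ('v \<Rightarrow> 'v \<Rightarrow> real) \<Rightarrow> ('v \<Rightarrow> real) \<Rightarrow> 'v \<Rightarrow> 'v \<Rightarrow> real" where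
  "Bcoef F \<Phi> u i j =
     (\<Sum>f\<in>{f\<in>F. i \<in> f \<and> j \<in> f}. deriv (\<lambda>x. corner_angle \<Phi> (u(j := x)) i f) (u j))"

definition Acoef :: "'v set set \<Rightarrow> ('v \<Rightarrow> 'v \<Rightarrow> real) \<Rightarrow> ('v \<Rightarrow> real) \<Rightarrow> 'v \<Rightarrow> real" where
  "Acoef F \<Phi> u i =
     deriv (\<lambda>x. \<Sum>f\<in>{f\<in>F. i \<in> f}. face_area \<Phi> (u(i := x)) f) (u i)"

definition calabi_rhs :: "'v::finite set set \<Rightarrow> ('v \<Rightarrow> 'v \<Rightarrow> real) \<Rightarrow> real \<Rightarrow> ('v \<Rightarrow> real) \<Rightarrow> 'v \<Rightarrow> real" where
  "calabi_rhs F \<Phi> p u i =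
     (\<Sum>j\<in>{j. adjacent F i j}.
        Bcoef F \<Phi> u i j * (\<bar>curvature F \<Phi> u j - curvature F \<Phi> u i\<bar> powr (p - 2)
                             * (curvature F \<Phi> u j - curvature F \<Phi> u i)))
     - Acoef F \<Phi> u i * curvature F \<Phi> u i"

end

theory Submission
  imports Defs "HOL-Complex_Analysis.Great_Picard"
begin

text \<open>The right-hand side of the flow is only continuous when \<open>p < 2\<close>, so solutions come from
Peano's theorem; for a bounded continuous field they are global. A field that is bounded on all
of $\mathbb{R}^N$ is obtained by truncating at \<open>u \<le> M\<close> with \<open>M < 0\<close>, and two facts make this work.

In the coordinates \<open>u\<close> one has $\partial\theta_i/\partial u_j = \partial\theta_j/\partial u_i \ge 0$
and $\partial\mathrm{Area}/\partial u_i = \sum_j (\partial\theta_i/\partial u_j)(\cosh l_{ij} - 1)$.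
Under the star condition the numerator of $\partial\theta_i/\partial u_j$ and the Gram determinant of
the triangle are sums of nonnegative terms, and comparing them term by term shows that
$\partial\theta_i/\partial u_j$ is bounded on \<open>u \<le> M\<close>, even when some radii tend to \<open>0\<close>. Hence
the right-hand side is bounded there and no $u_i$ reaches $-\infty$ in finite time.

If $u_i$ is close to \<open>0\<close>, then all angles at \<open>i\<close> are tiny and $\cosh l_{ij} \ge 2$, so that
$K_j - K_i \le 1$, $K_i \ge 2\pi - 1$ and
$u_i' \le \sum_j B_{ij} (1 - (\cosh l_{ij} - 1) K_i) \le 0$. Thus \<open>M\<close> is a barrier.\<close>

subsection \<open>Peano existence\<close>

text \<open>The delicate point is uniformity as radii shrink. For small radii the terms of
  \<open>dangle_num\<close> have degree 4, the root of \<open>gram\<close> generically has degree 2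
  and \<open>a^2 - 1\<close> has degree 2. The quotient has degree 0, so scaling alone does not
  decide, and the radii may vanish at different rates. Tangency (Phi = 0) is critical: the summand
  of the Gram determinant with 1 - cos^2 Phi vanishes there and another one must replace it.

  All estimates are phrased in cosh of lengths and radii. Since du = dr / sinh r, derivatives in u
  remain polynomial in cosh l and cosh r, and a positive Gram determinant takes over the role of the
  triangle inequalities.

  Expressing A_i by the B_ij turns the right-hand side into one sum over edges with nonnegative
  weights, so its sign at the barrier is decided edge by edge. The bound 1 for K_j - K_i is chosen
  because 1 is fixed by the power p - 1, so one threshold serves every p > 1. The estimate at a
  vertex holds for arbitrary negative values at the others, hence the barrier is a scalar argument
  for each coordinate.\<close>

lemma euler_steps_approx:
  fixes X :: "nat \<Rightarrow> 'a::real_normed_vector"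
  assumes step: "\<And>k. X (Suc k) = X k + h *\<^sub>R g (X k)" and "0 \<le> h" "j \<le> k"
    and near: "\<And>m. j \<le> m \<Longrightarrow> m < k \<Longrightarrow> norm (g (X m) - c) \<le> \<epsilon>"
  shows "norm (X k - X j - (h * (real k - real j)) *\<^sub>R c) \<le> h * (real k - real j) * \<epsilon>"
  using \<open>j \<le> k\<close> near
proof (induction k rule: dec_induct)
  case base
  then show ?case by simp
next
  case (step n)
  have "X (Suc n) - X j - (h * (real (Suc n) - real j)) *\<^sub>R c
      = (X n - X j - (h * (real n - real j)) *\<^sub>R c) + h *\<^sub>R (g (X n) - c)"
    by (simp add: assms(1) algebra_simps)
  also have "norm \<dots> \<le> h * (real n - real j) * \<epsilon> + h * \<epsilon>"
  proof (rule order_trans[OF norm_triangle_ineq add_mono])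
    show "norm (X n - X j - (h * (real n - real j)) *\<^sub>R c) \<le> h * (real n - real j) * \<epsilon>"
      using step.IH step.prems by simp
    show "norm (h *\<^sub>R (g (X n) - c)) \<le> h * \<epsilon>"
      using step.prems[of n] step.hyps \<open>0 \<le> h\<close> by (simp add: mult_left_mono)
  qed
  finally show ?case by (simp add: algebra_simps)
qed

lemma grid_time_tendsto:
  assumes "0 \<le> t"
  shows "(\<lambda>n. real (nat \<lfloor>t * real (Suc n)\<rfloor>) / real (Suc n)) \<longlonglongrightarrow> t"
proof (rule tendsto_sandwich)
  have fl: "real (nat \<lfloor>t * real (Suc n)\<rfloor>) = of_int \<lfloor>t * real (Suc n)\<rfloor>" for n
    using assms by simp
  show "\<forall>\<^sub>F n in sequentially. t - 1 / real (Suc n) \<le> real (nat \<lfloor>t * real (Suc n)\<rfloor>) / real (Suc n)"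
  proof (intro always_eventually allI)
    fix n
    have "t * real (Suc n) - 1 \<le> of_int \<lfloor>t * real (Suc n)\<rfloor>" by linarith
    then have "(t * real (Suc n) - 1) / real (Suc n) \<le> of_int \<lfloor>t * real (Suc n)\<rfloor> / real (Suc n)"
      by (rule divide_right_mono) simp
    then show "t - 1 / real (Suc n) \<le> real (nat \<lfloor>t * real (Suc n)\<rfloor>) / real (Suc n)"
      unfolding fl by (simp add: diff_divide_distrib)
  qed
  show "\<forall>\<^sub>F n in sequentially. real (nat \<lfloor>t * real (Suc n)\<rfloor>) / real (Suc n) \<le> t"
  proof (intro always_eventually allI)
    fix n
    have "of_int \<lfloor>t * real (Suc n)\<rfloor> \<le> t * real (Suc n)" by linarith
    then show "real (nat \<lfloor>t * real (Suc n)\<rfloor>) / real (Suc n) \<le> t"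
      unfolding fl by (subst pos_divide_le_eq) simp_all
  qed
  have "(\<lambda>n. t - 1 / real (Suc n)) \<longlonglongrightarrow> t - 0"
    by (intro tendsto_diff tendsto_const LIMSEQ_Suc[OF lim_1_over_n])
  then show "(\<lambda>n. t - 1 / real (Suc n)) \<longlonglongrightarrow> t" by simp
qed simp

text \<open>Euler's method with mesh 1/(n+1). A diagonal subsequence converges at the nonnegative
  rationals, and a common Lipschitz bound, valid up to one mesh width, carries convergence to all
  times. The derivative of the limit is read off from the Euler steps themselves, with no integral
  equation. The global speed bound \<open>C\<close> gives the whole half-line at once.\<close>

lemma peano_global:
  fixes g :: "'a::euclidean_space \<Rightarrow> 'a"
  assumes cont: "continuous_on UNIV g" and bdd: "bounded (range g)"
  shows "\<exists>u. u 0 = x0 \<and> (\<forall>t\<ge>0. (u has_vector_derivative g (u t)) (at t within {0..}))"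
proof -
  obtain C where C: "C > 0" "\<And>x. norm (g x) \<le> C"
    using bdd unfolding bounded_pos by blast
  define X where "X n k = ((\<lambda>x. x + (1 / real (Suc n)) *\<^sub>R g x) ^^ k) x0" for n k
  define N where "N n t = nat \<lfloor>t * real (Suc n)\<rfloor>" for n t
  define U where "U n t = X n (N n t)" for n t
  have step: "X n (Suc k) = X n k + (1 / real (Suc n)) *\<^sub>R g (X n k)" for n k
    by (simp add: X_def)
  have Nmono: "N n a \<le> N n b" if "a \<le> b" for n a b
    using that unfolding N_def by (intro nat_mono floor_mono mult_right_mono) auto
  have Ndiff: "1 / real (Suc n) * (real (N n b) - real (N n a)) \<le> b - a + 1 / real (Suc n)"
    if "0 \<le> a" "a \<le> b" for n a b
  proof -
    have "real (N n b) \<le> b * real (Suc n)" "real (N n a) \<ge> a * real (Suc n) - 1"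
      unfolding N_def using that by (auto simp: of_nat_floor)
    then have "real (N n b) - real (N n a) \<le> (b - a) * real (Suc n) + 1"
      by (simp add: algebra_simps)
    then have "1 / real (Suc n) * (real (N n b) - real (N n a)) \<le> 1 / real (Suc n) * ((b - a) * real (Suc n) + 1)"
      by (intro mult_left_mono) auto
    also have "\<dots> = b - a + 1 / real (Suc n)" by (simp add: field_simps del: of_nat_Suc)
    finally show ?thesis .
  qed
  \<comment> \<open>The Euler estimate with comparison velocity 0 and error \<open>C\<close>; the
    second use, in \<open>key\<close>, compares with the velocity \<open>g (u t)\<close>.\<close>
  have Xlip: "norm (X n k - X n j) \<le> 1 / real (Suc n) * (real k - real j) * C" if "j \<le> k" for n j k
    using euler_steps_approx[of "X n" "1 / real (Suc n)" g j k 0 C] step that C(2) by simp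
  \<comment> \<open>\<open>U n\<close> is a step function of time, and an interval may contain one
    grid point more than its length predicts; hence the additional mesh width.\<close>
  have Ulip: "norm (U n b - U n a) \<le> (b - a + 1 / real (Suc n)) * C" if "0 \<le> a" "a \<le> b" for n a b
    unfolding U_def using Xlip[OF Nmono[OF that(2)]] Ndiff[OF that] C(1)
    by (meson less_imp_le mult_right_mono order_trans)
  have U0: "U n 0 = x0" for n by (simp add: U_def N_def X_def)
  \<comment> \<open>The library's diagonal lemma wants a bound uniform in the index, hence the rescaling.\<close>
  define W where "W q = norm x0 + (q + 1) * C" for q :: real
  have W: "W q > 0" if "0 \<le> q" for q
    using that C(1) by (auto simp: W_def intro!: add_nonneg_pos)
  have "countable {q \<in> \<rat>. 0 \<le> (q::real)}"
    by (rule countable_subset[OF _ countable_rat]) auto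
  moreover have "norm ((1 / W q) *\<^sub>R U n q) \<le> 1" if "q \<in> {q \<in> \<rat>. 0 \<le> q}" for n q
  proof -
    have q: "0 \<le> q" using that by simp
    have "norm (U n q) \<le> norm x0 + norm (U n q - U n 0)"
      using norm_triangle_sub[of "U n q" x0] U0 by simp
    also have "norm (U n q - U n 0) \<le> (q - 0 + 1 / real (Suc n)) * C"
      using Ulip[of 0 q n] q by simp
    also have "\<dots> \<le> (q + 1) * C"
      using C(1) by (intro mult_right_mono) auto
    finally have "norm (U n q) \<le> W q" by (simp add: W_def)
    then show ?thesis using W[OF q] by (simp add: divide_le_eq)
  qed
  ultimately obtain k :: "nat \<Rightarrow> nat" where k: "strict_mono k"
    and kW: "\<And>q. q \<in> {q \<in> \<rat>. 0 \<le> q} \<Longrightarrow> \<exists>l. (\<lambda>n. (1 / W q) *\<^sub>R U (k n) q) \<longlonglongrightarrow> l"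
    using function_convergent_subsequence[of "{q \<in> \<rat>. 0 \<le> (q::real)}" "\<lambda>n q. (1 / W q) *\<^sub>R U n q" 1]
    by blast
  have kq: "\<exists>l. (\<lambda>n. U (k n) q) \<longlonglongrightarrow> l" if q: "q \<in> \<rat>" "0 \<le> q" for q
  proof -
    obtain l where "(\<lambda>n. (1 / W q) *\<^sub>R U (k n) q) \<longlonglongrightarrow> l" using kW q by auto
    from tendsto_scaleR[OF tendsto_const[of "W q"] this]
    show ?thesis using W[OF q(2)] by auto
  qed
  have hk0: "(\<lambda>n. 1 / real (Suc (k n))) \<longlonglongrightarrow> 0"
    using LIMSEQ_subseq_LIMSEQ[OF LIMSEQ_Suc[OF lim_1_over_n] k] by (simp add: comp_def)
  have conv: "\<exists>l. (\<lambda>n. U (k n) t) \<longlonglongrightarrow> l" if t: "0 \<le> t" for t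
  proof -
    have "Cauchy (\<lambda>n. U (k n) t)"
    proof (rule metric_CauchyI)
      fix e :: real assume e: "e > 0"
      \<comment> \<open>Moving from \<open>t\<close> to \<open>q\<close> costs at most the time gap
        plus one mesh, each below e/(6C), times the speed \<open>C\<close>: that is e/3.\<close>
      obtain q where q: "q \<in> \<rat>" "t < q" "q < t + e / (6 * C)"
        using Rats_dense_in_real[of t "t + e / (6 * C)"] e C(1) by auto
      have "Cauchy (\<lambda>n. U (k n) q)"
        using kq[of q] q t by (auto intro: LIMSEQ_imp_Cauchy)
      then obtain M1 where M1: "\<And>m n. m \<ge> M1 \<Longrightarrow> n \<ge> M1 \<Longrightarrow> dist (U (k m) q) (U (k n) q) < e / 3"
        using metric_CauchyD[of _ "e / 3"] e by (metis divide_pos_pos zero_less_numeral)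
      have "\<forall>\<^sub>F n in sequentially. 1 / real (Suc (k n)) < e / (6 * C)"
        using hk0 e C(1) by (intro order_tendstoD) auto
      then obtain M2 where M2: "\<And>n. n \<ge> M2 \<Longrightarrow> 1 / real (Suc (k n)) < e / (6 * C)"
        unfolding eventually_sequentially by blast
      have near: "dist (U (k n) q) (U (k n) t) < e / 3" if "n \<ge> M2" for n
      proof -
        have "norm (U (k n) q - U (k n) t) \<le> (q - t + 1 / real (Suc (k n))) * C"
          using Ulip t q by simp
        also have "\<dots> < (e / (6 * C) + e / (6 * C)) * C"
          using M2[OF that] q C(1) by (intro mult_strict_right_mono) auto
        also have "\<dots> = e / 3" using C(1) by simp
        finally show ?thesis by (simp add: dist_norm)
      qed
      show "\<exists>M. \<forall>m\<ge>M. \<forall>n\<ge>M. dist (U (k m) t) (U (k n) t) < e"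
      proof (intro exI allI impI)
        fix m n assume mn: "max M1 M2 \<le> m" "max M1 M2 \<le> n"
        have "dist (U (k m) t) (U (k n) t) \<le> dist (U (k m) q) (U (k m) t)
            + dist (U (k m) q) (U (k n) q) + dist (U (k n) q) (U (k n) t)"
          by (metis add.commute add_mono dist_commute dist_triangle2 dist_triangle_le order_refl)
        also have "\<dots> < e" using near[of m] near[of n] M1[of m n] mn by auto
        finally show "dist (U (k m) t) (U (k n) t) < e" .
      qed
    qed
    then show ?thesis using Cauchy_convergent_iff convergent_def by blast
  qed
  define u where "u t = lim (\<lambda>n. U (k n) t)" for t
  have u: "(\<lambda>n. U (k n) t) \<longlonglongrightarrow> u t" if "0 \<le> t" for t
    using conv[OF that] unfolding u_def by (metis convergent_def convergent_LIMSEQ_iff)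
  have gridk: "(\<lambda>n. 1 / real (Suc (k n)) * real (N (k n) t)) \<longlonglongrightarrow> t" if "0 \<le> t" for t
    using LIMSEQ_subseq_LIMSEQ[OF grid_time_tendsto[OF that] k] by (simp add: comp_def N_def)
  have ulip: "norm (u b - u a) \<le> (b - a) * C" if "0 \<le> a" "a \<le> b" for a b
  proof -
    have "(\<lambda>n. norm (U (k n) b - U (k n) a)) \<longlonglongrightarrow> norm (u b - u a)"
      using that by (intro tendsto_intros u) auto
    moreover have "(\<lambda>n. (b - a + 1 / real (Suc (k n))) * C) \<longlonglongrightarrow> (b - a + 0) * C"
      by (intro tendsto_intros hk0)
    ultimately show ?thesis
      using Ulip[OF that] by (intro LIMSEQ_le[where X = "\<lambda>n. norm (U (k n) b - U (k n) a)"]) auto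
  qed
  have deriv: "(u has_vector_derivative g (u t)) (at t within {0..})" if t: "0 \<le> t" for t
    unfolding has_vector_derivative_def has_derivative_within_alt
  proof (intro conjI allI impI)
    show "bounded_linear (\<lambda>x. x *\<^sub>R g (u t))" by (rule bounded_linear_scaleR_left)
    fix e :: real assume e: "e > 0"
    obtain \<delta> where \<delta>: "\<delta> > 0" "\<And>x. dist x (u t) < \<delta> \<Longrightarrow> dist (g x) (g (u t)) < e"
      using cont e unfolding continuous_on_iff by (metis UNIV_I)
    \<comment> \<open>Budget for staying in the \<delta>-ball around \<open>u t\<close>: the Euler
      points move by at most 3\<eta>C = \<delta>/2 (interval below 2\<eta> plus one mesh), and
      \<open>U (k n) a\<close> to \<open>u a\<close> and \<open>u a\<close> to \<open>u t\<close>
      cost at most \<delta>/6 each.\<close>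
    define \<eta> where "\<eta> = \<delta> / (6 * C)"
    have \<eta>: "\<eta> > 0" "\<eta> * C = \<delta> / 6" using \<delta> C(1) by (auto simp: \<eta>_def)
    \<comment> \<open>Stated for an arbitrary interval near \<open>t\<close>, so that it covers
      difference quotients from the right and from the left.\<close>
    have key: "norm (u b - u a - (b - a) *\<^sub>R g (u t)) \<le> (b - a) * e"
      if ab: "0 \<le> a" "a \<le> b" "\<bar>a - t\<bar> < \<eta>" "\<bar>b - t\<bar> < \<eta>" for a b
    proof (rule LIMSEQ_le)
      let ?s = "\<lambda>n. 1 / real (Suc (k n)) * (real (N (k n) b) - real (N (k n) a))"
      have lims: "?s \<longlonglongrightarrow> b - a"
        using tendsto_diff[OF gridk[of b] gridk[of a]] ab by (simp add: right_diff_distrib)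
      show "(\<lambda>n. norm (U (k n) b - U (k n) a - ?s n *\<^sub>R g (u t))) \<longlonglongrightarrow> norm (u b - u a - (b - a) *\<^sub>R g (u t))"
        using ab by (intro tendsto_intros u lims) auto
      show "(\<lambda>n. ?s n * e) \<longlonglongrightarrow> (b - a) * e" by (intro tendsto_intros lims)
      have "\<forall>\<^sub>F n in sequentially. 1 / real (Suc (k n)) < \<eta>"
        using hk0 \<eta> by (intro order_tendstoD) auto
      moreover have "\<forall>\<^sub>F n in sequentially. dist (U (k n) a) (u a) < \<delta> / 6"
        using u[OF ab(1)] \<delta> by (intro tendstoD) auto
      ultimately have "\<forall>\<^sub>F n in sequentially.
          norm (U (k n) b - U (k n) a - ?s n *\<^sub>R g (u t)) \<le> ?s n * e"
      proof eventually_elim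
        case (elim n)
        have near: "norm (g (X (k n) m) - g (u t)) \<le> e" if m: "N (k n) a \<le> m" "m < N (k n) b" for m
        proof -
          have "norm (X (k n) m - U (k n) a) \<le> 1 / real (Suc (k n)) * (real m - real (N (k n) a)) * C"
            unfolding U_def by (rule Xlip[OF m(1)])
          also have "\<dots> \<le> ?s n * C"
            using m C(1) by (intro mult_right_mono mult_left_mono) auto
          also have "\<dots> \<le> (3 * \<eta>) * C"
            using Ndiff[OF ab(1,2), of "k n"] elim ab C(1) by (intro mult_right_mono) auto
          finally have 1: "norm (X (k n) m - U (k n) a) \<le> \<delta> / 2" using \<eta> by simp
          have "norm (u a - u t) \<le> \<bar>a - t\<bar> * C"
            using ulip[of a t] ulip[of t a] ab(1) t by (cases "a \<le> t") (auto simp: norm_minus_commute)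
          also have "\<dots> \<le> \<eta> * C" using ab C(1) by (intro mult_right_mono) auto
          finally have 2: "norm (u a - u t) \<le> \<delta> / 6" using \<eta> by simp
          have "dist (X (k n) m) (u t) \<le> dist (X (k n) m) (U (k n) a) + dist (U (k n) a) (u a) + dist (u a) (u t)"
            by (meson add_right_mono dist_triangle dist_triangle2 order_trans dist_triangle_le)
          also have "\<dots> < \<delta>" using 1 2 elim \<delta>(1) by (simp add: dist_norm)
          finally show ?thesis using \<delta>(2) by (simp add: dist_norm less_imp_le)
        qed
        show ?case
          unfolding U_def
          by (rule euler_steps_approx[of "X (k n)" "1 / real (Suc (k n))" g])
             (use step Nmono ab near in auto)
      qed
      then show "\<exists>M. \<forall>n\<ge>M. norm (U (k n) b - U (k n) a - ?s n *\<^sub>R g (u t)) \<le> ?s n * e"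
        unfolding eventually_sequentially .
    qed
    show "\<exists>d>0. \<forall>s\<in>{0..}. norm (s - t) < d \<longrightarrow>
        norm (u s - u t - (s - t) *\<^sub>R g (u t)) \<le> e * norm (s - t)"
    proof (intro exI conjI ballI impI)
      show "\<eta> > 0" by fact
      fix s assume s: "s \<in> {0..}" "norm (s - t) < \<eta>"
      show "norm (u s - u t - (s - t) *\<^sub>R g (u t)) \<le> e * norm (s - t)"
      proof (cases "s \<ge> t")
        case True
        then show ?thesis using key[of t s] s t \<eta> by (simp add: mult.commute)
      next
        case False
        have "u s - u t - (s - t) *\<^sub>R g (u t) = - (u t - u s - (t - s) *\<^sub>R g (u t))"
          by (simp add: algebra_simps)
        then have "norm (u s - u t - (s - t) *\<^sub>R g (u t)) = norm (u t - u s - (t - s) *\<^sub>R g (u t))"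
          by (simp only: norm_minus_cancel)
        then show ?thesis using False key[of s t] s t \<eta> by (simp add: mult.commute)
      qed
    qed
  qed
  have "u 0 = x0" by (simp add: u_def U0)
  then show ?thesis using deriv by blast
qed

subsection \<open>Radii and edge lengths\<close>

lemma radius_pos: "x < 0 \<Longrightarrow> 0 < radius x"
  unfolding radius_def artanh_def by (simp add: add_pos_pos divide_simps)

lemma exp_radius:
  assumes "x < 0"
  shows "exp (radius x) = (1 + exp x) / (1 - exp x)"
proof -
  have "0 < (1 + exp x) / (1 - exp x)" using assms by (intro divide_pos_pos add_pos_pos) auto
  then show ?thesis unfolding radius_def artanh_def by simp
qed

lemma sinh_radius:
  assumes "x < 0"
  shows "sinh (radius x) = 2 * exp x / (1 - exp x ^ 2)"
proof -
  define y where "y = exp x"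
  have "0 < y" "y < 1" using assms by (auto simp: y_def)
  then have y: "1 - y > 0" "1 + y > 0" by auto
  have "sinh (radius x) = ((1 + y) / (1 - y) - (1 - y) / (1 + y)) / 2"
    unfolding sinh_def exp_minus exp_radius[OF assms] y_def by simp
  also have "\<dots> = ((1 + y) * (1 + y) - (1 - y) * (1 - y)) / ((1 - y) * (1 + y)) / 2"
    using y by (simp add: diff_frac_eq)
  also have "(1 + y) * (1 + y) - (1 - y) * (1 - y) = 4 * y" by (simp add: algebra_simps)
  also have "(1 - y) * (1 + y) = 1 - y\<^sup>2" by (simp add: algebra_simps power2_eq_square)
  also have "4 * y / w / 2 = 2 * y / w" for w by (simp add: field_simps)
  finally show ?thesis by (simp add: y_def)
qed

text \<open>The relation dr/du = sinh r is what singles out the coordinate u: it keeps the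
  derivatives of cosh r and sinh r polynomial.\<close>

lemma has_real_derivative_radius:
  assumes "x < 0"
  shows "(radius has_real_derivative sinh (radius x)) (at x)"
proof -
  have "exp x < 1" "0 < exp x" using assms by auto
  then show ?thesis
    unfolding sinh_radius[OF assms] unfolding radius_def[abs_def]
    by (auto intro!: derivative_eq_intros artanh_real_has_field_derivative[THEN DERIV_chain2])
qed

lemma sinh_radius_pos: "x < 0 \<Longrightarrow> 0 < sinh (radius x)"
  using radius_pos by simp

lemma cosh_radius_mono: "x \<le> y \<Longrightarrow> y < 0 \<Longrightarrow> cosh (radius x) \<le> cosh (radius y)"
proof -
  assume xy: "x \<le> y" "y < 0"
  then have "artanh (exp x) \<le> artanh (exp y)"
    unfolding artanh_def by (auto intro!: ln_mono divide_pos_pos add_pos_pos frac_le)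
  then show ?thesis
    using radius_pos[of x] xy by (intro iffD2[OF cosh_real_nonneg_le_iff]) (auto simp: radius_def)
qed

lemma sinh_radius_le_cosh: "sinh (radius x) \<le> cosh (radius x)"
  by (simp add: sinh_def cosh_def)

lemma filterlim_cosh_radius_at_left_0: "filterlim (\<lambda>x. cosh (radius x)) at_top (at_left 0)"
proof -
  have "filterlim (\<lambda>x::real. artanh (exp x)) at_top (at_left 0)"
  proof (rule filterlim_compose[OF artanh_real_at_left_1])
    show "filterlim exp (at_left 1) (at_left (0::real))"
      unfolding filterlim_at
      by (auto simp: eventually_at_filter intro!: tendsto_eq_intros)
  qed
  then have "filterlim radius at_top (at_left 0)"
    unfolding radius_def[abs_def] by (intro filterlim_tendsto_pos_mult_at_top[OF tendsto_const]) auto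
  then show ?thesis by (rule filterlim_compose[OF cosh_real_at_top])
qed

text \<open>This is cosh of the edge length. Using it instead of \<open>elen\<close> removes
  \<open>arcosh\<close> from all later formulas; \<open>cosh_elen\<close> and
  \<open>sinh_elen\<close> translate back once it exceeds 1.\<close>

definition edge_cosh :: "('v \<Rightarrow> 'v \<Rightarrow> real) \<Rightarrow> ('v \<Rightarrow> real) \<Rightarrow> 'v \<Rightarrow> 'v \<Rightarrow> real" where
  "edge_cosh \<Phi> u i j = cosh (radius (u i)) * cosh (radius (u j))
                  + sinh (radius (u i)) * sinh (radius (u j)) * cos (\<Phi> i j)"

text \<open>The left side is a combination of C_i C_j with weight \<open>d\<close> and cosh(r_i -
  r_j) >= 1 with weight \<open>1 - d\<close>, plus a remainder sinh r_i sinh r_j (cos Phi + 1 - d)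
  >= 0. The number \<open>d\<close> measures how far the weight stays below pi.\<close>

lemma edge_cosh_ge:
  assumes "0 \<le> d" "d \<le> 1" "d \<le> 1 + cos (\<Phi> i j)" "u i < 0" "u j < 0"
  shows "edge_cosh \<Phi> u i j \<ge> d * cosh (radius (u i)) * cosh (radius (u j)) + (1 - d)"
proof -
  let ?Ci = "cosh (radius (u i))" and ?Cj = "cosh (radius (u j))"
  let ?Si = "sinh (radius (u i))" and ?Sj = "sinh (radius (u j))"
  have S: "0 \<le> ?Si * ?Sj" using sinh_radius_pos assms by (simp add: less_imp_le)
  have "1 \<le> cosh (radius (u i) - radius (u j))" by (rule cosh_real_ge_1)
  then have "(1 - d) * 1 \<le> (1 - d) * (?Ci * ?Cj - ?Si * ?Sj)"
    using assms by (intro mult_left_mono) (auto simp: cosh_diff)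
  moreover have "?Si * ?Sj * (d - 1) \<le> ?Si * ?Sj * cos (\<Phi> i j)"
    using assms S by (intro mult_left_mono) auto
  ultimately show ?thesis unfolding edge_cosh_def by (simp add: algebra_simps)
qed

lemma edge_cosh_gt_1:
  assumes "-1 < cos (\<Phi> i j)" "u i < 0" "u j < 0"
  shows "1 < edge_cosh \<Phi> u i j"
proof -
  define d where "d = min 1 (1 + cos (\<Phi> i j))"
  have d: "0 < d" "d \<le> 1" "d \<le> 1 + cos (\<Phi> i j)" using assms by (auto simp: d_def)
  have "1 < cosh (radius (u i))" "1 \<le> cosh (radius (u j))"
    using radius_pos[of "u i"] assms cosh_real_ge_1[of "radius (u i)"] cosh_real_one_iff[of "radius (u i)"]
    by (auto simp: cosh_real_ge_1 less_le)
  then have "1 * 1 < cosh (radius (u i)) * cosh (radius (u j))"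
    by (intro mult_less_le_imp_less) auto
  then have "d * 1 < d * (cosh (radius (u i)) * cosh (radius (u j)))"
    using d by (intro mult_strict_left_mono) auto
  then show ?thesis using edge_cosh_ge[of d \<Phi> i j u] d assms unfolding mult.assoc by linarith
qed

lemma edge_cosh_le:
  assumes "u i < 0" "u j < 0"
  shows "edge_cosh \<Phi> u i j \<le> 2 * cosh (radius (u i)) * cosh (radius (u j))"
proof -
  have "sinh (radius (u i)) * sinh (radius (u j)) * cos (\<Phi> i j) \<le>
      sinh (radius (u i)) * sinh (radius (u j)) * 1"
    using sinh_radius_pos assms by (intro mult_left_mono) (auto simp: less_imp_le)
  also have "\<dots> \<le> cosh (radius (u i)) * cosh (radius (u j))"
    using sinh_radius_pos sinh_radius_le_cosh assms by (simp add: mult_mono less_imp_le)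
  finally show ?thesis unfolding edge_cosh_def by simp
qed

lemma cosh_elen: "1 < edge_cosh \<Phi> u i j \<Longrightarrow> cosh (elen \<Phi> u i j) = edge_cosh \<Phi> u i j"
  unfolding elen_def edge_cosh_def[symmetric] by (simp add: cosh_arcosh_real)

lemma sinh_elen: "1 < edge_cosh \<Phi> u i j \<Longrightarrow> sinh (elen \<Phi> u i j) = sqrt ((edge_cosh \<Phi> u i j)\<^sup>2 - 1)"
  unfolding elen_def edge_cosh_def[symmetric] by (simp add: sinh_arcosh_real)

lemma edge_cosh_commute: "\<Phi> i j = \<Phi> j i \<Longrightarrow> edge_cosh \<Phi> u i j = edge_cosh \<Phi> u j i"
  unfolding edge_cosh_def by (simp add: mult.commute)

text \<open>In these coordinates the derivative of \<^term>\<open>cosh l\<close> at one end is linear in \<^term>\<open>cosh l\<close>.\<close>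

lemma edge_cosh_deriv_left:
  assumes "i \<noteq> j" "u i < 0"
  shows "((\<lambda>x. edge_cosh \<Phi> (u(i := x)) i j) has_real_derivative
    cosh (radius (u i)) * edge_cosh \<Phi> u i j - cosh (radius (u j))) (at (u i))"
proof -
  have "((\<lambda>x. cosh (radius x) * cosh (radius (u j)) + sinh (radius x) * sinh (radius (u j)) * cos (\<Phi> i j))
      has_real_derivative (cosh (radius (u i)) * edge_cosh \<Phi> u i j - cosh (radius (u j)))) (at (u i))"
    unfolding edge_cosh_def
    by (rule derivative_eq_intros has_real_derivative_radius assms refl)+
      (use hyperbolic_pythagoras[of "radius (u i)"] in algebra)
  then show ?thesis using assms by (simp add: edge_cosh_def)
qed

lemma edge_cosh_deriv_right:
  assumes "i \<noteq> j" "u j < 0"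
  shows "((\<lambda>x. edge_cosh \<Phi> (u(j := x)) i j) has_real_derivative
    cosh (radius (u j)) * edge_cosh \<Phi> u i j - cosh (radius (u i))) (at (u j))"
proof -
  have "((\<lambda>x. cosh (radius (u i)) * cosh (radius x) + sinh (radius (u i)) * sinh (radius x) * cos (\<Phi> i j))
      has_real_derivative (cosh (radius (u j)) * edge_cosh \<Phi> u i j - cosh (radius (u i)))) (at (u j))"
    unfolding edge_cosh_def
    by (rule derivative_eq_intros has_real_derivative_radius assms refl)+
      (use hyperbolic_pythagoras[of "radius (u j)"] in algebra)
  then show ?thesis using assms by (simp add: edge_cosh_def)
qed

subsection \<open>Hyperbolic triangles\<close>

text \<open>For a triangle with side hyperbolic cosines $a = \cosh l_{ij}$, $b = \cosh l_{ik}$,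
$c = \cosh l_{jk}$ the quantity \<open>gram a b c\<close> is
$(\sinh l_{ij} \sinh l_{ik} \sin\theta_i)^2$.\<close>

definition gram :: "real \<Rightarrow> real \<Rightarrow> real \<Rightarrow> real" where
  "gram a b c = 1 + 2 * a * b * c - a\<^sup>2 - b\<^sup>2 - c\<^sup>2"

text \<open>The numerator of $\partial\theta_i/\partial u_j$, see \<open>angle_deriv_neighbour\<close> below.\<close>

definition dangle_num :: "real \<Rightarrow> real \<Rightarrow> real \<Rightarrow> real \<Rightarrow> real \<Rightarrow> real \<Rightarrow> real" where
  "dangle_num Ci Cj Ck a b c = Cj * (a * b - c) + Ci * (a * c - b) - Ck * (a\<^sup>2 - 1)"

definition dangle :: "real \<Rightarrow> real \<Rightarrow> real \<Rightarrow> real \<Rightarrow> real \<Rightarrow> real \<Rightarrow> real" where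
  "dangle Ci Cj Ck a b c = dangle_num Ci Cj Ck a b c / (sqrt (gram a b c) * (a\<^sup>2 - 1))"

lemma gram_commute: "gram a b c = gram b a c"
  by (simp add: gram_def)

text \<open>Algebraic form of the symmetry of the angle Jacobian: exchanging i and j swaps the sides
  \<open>b\<close> and \<open>c\<close>.\<close>

lemma dangle_commute: "dangle Ci Cj Ck a b c = dangle Cj Ci Ck a c b"
  by (simp add: dangle_def dangle_num_def gram_def algebra_simps)

text \<open>As a*b - c = sinh l_ij sinh l_ik cos theta_i by the cosine law, this is sin^2 = 1 -
  cos^2 up to scaling.\<close>

lemma gram_eq_diff: "gram a b c = (a\<^sup>2 - 1) * (b\<^sup>2 - 1) - (a * b - c)\<^sup>2"
  by (simp add: gram_def power2_eq_square algebra_simps)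

text \<open>The classical variation formula sinh l_ij sinh l_ik sin theta_i d theta_i = sinh l_jk
  (dl_jk - cos theta_j dl_ij - cos theta_k dl_ik), with dl replaced by d(cosh l). For instance (a c
  - b)/(a^2 - 1) is sinh l_jk cos theta_j / sinh l_ij.\<close>

lemma cos_law_has_real_derivative:
  fixes a b c :: "real \<Rightarrow> real"
  assumes der: "(a has_real_derivative a') (at t)" "(b has_real_derivative b') (at t)"
      "(c has_real_derivative c') (at t)"
    and gt: "1 < a t" "1 < b t" and G: "0 < gram (a t) (b t) (c t)"
  shows "((\<lambda>s. arccos ((a s * b s - c s) / (sqrt ((a s)\<^sup>2 - 1) * sqrt ((b s)\<^sup>2 - 1))))
    has_real_derivative (c' - a' * (a t * c t - b t) / ((a t)\<^sup>2 - 1)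
       - b' * (b t * c t - a t) / ((b t)\<^sup>2 - 1)) / sqrt (gram (a t) (b t) (c t))) (at t)"
proof -
  define A B where "A = sqrt ((a t)\<^sup>2 - 1)" and "B = sqrt ((b t)\<^sup>2 - 1)"
  have "1 < (a t)\<^sup>2" "1 < (b t)\<^sup>2" using gt by (simp_all add: one_less_power)
  then have AB: "0 < A" "0 < B" "A\<^sup>2 = (a t)\<^sup>2 - 1" "B\<^sup>2 = (b t)\<^sup>2 - 1"
    by (auto simp: A_def B_def)
  have AB0: "A \<noteq> 0" "B \<noteq> 0" using AB by auto
  define q where "q = (a t * b t - c t) / (A * B)"
  define n where "n = a t * b t - c t"
  have "gram (a t) (b t) (c t) = (A * B)\<^sup>2 - n\<^sup>2"
    unfolding gram_eq_diff AB(3,4)[symmetric] n_def by (simp add: power_mult_distrib)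
  then have q2: "1 - q\<^sup>2 = gram (a t) (b t) (c t) / (A * B)\<^sup>2"
    using AB0 unfolding q_def n_def[symmetric] by (simp add: power_divide diff_divide_distrib)
  have "0 < 1 - q\<^sup>2" unfolding q2 using G AB by simp
  then have q1: "-1 < q" "q < 1" by (simp_all add: abs_square_less_1 abs_less_iff)
  have sq: "sqrt (1 - q\<^sup>2) = sqrt (gram (a t) (b t) (c t)) / (A * B)"
    unfolding q2 using AB by (simp add: real_sqrt_divide)
  have dA: "((\<lambda>s. sqrt ((a s)\<^sup>2 - 1)) has_real_derivative a' * a t / A) (at t)"
    using \<open>1 < (a t)\<^sup>2\<close> unfolding A_def
    by (auto intro!: derivative_eq_intros der simp: divide_simps)
  have dB: "((\<lambda>s. sqrt ((b s)\<^sup>2 - 1)) has_real_derivative b' * b t / B) (at t)"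
    using \<open>1 < (b t)\<^sup>2\<close> unfolding B_def
    by (auto intro!: derivative_eq_intros der simp: divide_simps)
  define q' where "q' = ((a' * b t + b' * a t - c') * (A * B)
      - (a t * b t - c t) * (a' * a t / A * B + b' * b t / B * A)) / ((A * B) * (A * B))"
  have dq: "((\<lambda>s. (a s * b s - c s) / (sqrt ((a s)\<^sup>2 - 1) * sqrt ((b s)\<^sup>2 - 1)))
      has_real_derivative q') (at t)"
    unfolding q'_def A_def B_def
    by (rule DERIV_divide[OF DERIV_diff[OF DERIV_mult[OF der(1,2)] der(3)]
        DERIV_mult[OF dA[unfolded A_def] dB[unfolded B_def]]]) 
      (use AB0 in \<open>auto simp: A_def B_def\<close>)
  have "((\<lambda>s. arccos ((a s * b s - c s) / (sqrt ((a s)\<^sup>2 - 1) * sqrt ((b s)\<^sup>2 - 1))))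
      has_real_derivative inverse (- sqrt (1 - q\<^sup>2)) * q') (at t)"
    by (rule DERIV_chain2[OF _ dq]) (use DERIV_arccos[OF q1] in \<open>simp add: q_def A_def B_def\<close>)
  moreover have "inverse (- sqrt (1 - q\<^sup>2)) * q' = (c' - a' * (a t * c t - b t) / ((a t)\<^sup>2 - 1)
       - b' * (b t * c t - a t) / ((b t)\<^sup>2 - 1)) / sqrt (gram (a t) (b t) (c t))"
  proof -
    have a2: "a t * a t = A * A + 1" and b2: "b t * b t = B * B + 1"
      using AB by (simp_all add: power2_eq_square)
    have "A * B * q' = - (c' - a' * (a t * c t - b t) / A\<^sup>2 - b' * (b t * c t - a t) / B\<^sup>2)"
    proof -
      have distr: "A * A * (B * B) * - (c' - a' * u / A\<^sup>2 - b' * v / B\<^sup>2)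
          = - (A * A * (B * B) * c') + a' * (B * B) * u + b' * (A * A) * v" for u v
        using AB0 by (simp add: field_simps power2_eq_square)
      have "A * A * (B * B) * (A * B * q') = A * A * (B * B) * (a' * b t + b' * a t - c')
        - (a t * b t - c t) * (a' * a t * (B * B) + b' * b t * (A * A))"
        unfolding q'_def using AB0 by (simp add: field_simps)
      also have "\<dots> = - (A * A * (B * B) * c') + a' * (B * B) * (A * A * b t - (a t * a t) * b t + a t * c t)
          + b' * (A * A) * (B * B * a t - (b t * b t) * a t + b t * c t)"
        by (simp add: algebra_simps)
      also have "\<dots> = - (A * A * (B * B) * c') + a' * (B * B) * (a t * c t - b t)
          + b' * (A * A) * (b t * c t - a t)"
        unfolding a2 b2 by (simp add: algebra_simps)
      also have "\<dots> = A * A * (B * B) * - (c' - a' * (a t * c t - b t) / A\<^sup>2 - b' * (b t * c t - a t) / B\<^sup>2)"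
        by (simp only: distr)
      finally show ?thesis using AB0 by simp
    qed
    then show ?thesis unfolding sq using AB(3,4) by (simp add: divide_simps)
  qed
  ultimately show ?thesis by simp
qed

text \<open>Writing the side derivatives as in \<open>edge_cosh_deriv_left\<close>, the two variations
of an angle are expressed by \<^const>\<open>dangle\<close>.\<close>

lemma dangle_eq_neighbour:
  assumes "a\<^sup>2 \<noteq> 1"
  shows "((Cj * c - Ck) - (Cj * a - Ci) * (a * c - b) / (a\<^sup>2 - 1)) / sqrt (gram a b c)
    = dangle Ci Cj Ck a b c"
proof -
  have "(Cj * c - Ck) - (Cj * a - Ci) * (a * c - b) / (a\<^sup>2 - 1)
      = ((Cj * c - Ck) * (a\<^sup>2 - 1) - (Cj * a - Ci) * (a * c - b)) / (a\<^sup>2 - 1)"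
    using assms by (simp add: diff_divide_distrib)
  also have "(Cj * c - Ck) * (a\<^sup>2 - 1) - (Cj * a - Ci) * (a * c - b) = dangle_num Ci Cj Ck a b c"
    by (simp add: dangle_num_def power2_eq_square algebra_simps)
  finally show ?thesis by (simp add: dangle_def mult.commute)
qed

lemma dangle_eq_apex:
  assumes "a\<^sup>2 \<noteq> 1" "b\<^sup>2 \<noteq> 1"
  shows "(0 - (Ci * a - Cj) * (a * c - b) / (a\<^sup>2 - 1) - (Ci * b - Ck) * (b * c - a) / (b\<^sup>2 - 1))
      / sqrt (gram a b c) = - (dangle Ci Cj Ck a b c * a + dangle Ci Ck Cj b a c * b)"
proof -
  \<comment> \<open>Neither numerator is a multiple of \<open>dangle_num\<close> alone. The
    remainders contain the same factor a Ck - b Cj with opposite signs and cancel after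
    division.\<close>
  have 1: "(Ci * a - Cj) * (a * c - b) = dangle_num Ci Cj Ck a b c * a + (a * Ck - b * Cj) * (a\<^sup>2 - 1)"
    by (simp add: dangle_num_def power2_eq_square algebra_simps)
  have 2: "(Ci * b - Ck) * (b * c - a) = dangle_num Ci Ck Cj b a c * b - (a * Ck - b * Cj) * (b\<^sup>2 - 1)"
    by (simp add: dangle_num_def power2_eq_square algebra_simps)
  define P Q where "P = dangle_num Ci Cj Ck a b c / (a\<^sup>2 - 1)"
    and "Q = dangle_num Ci Ck Cj b a c / (b\<^sup>2 - 1)"
  have dP: "dangle Ci Cj Ck a b c = P / sqrt (gram a b c)"
    and dQ: "dangle Ci Ck Cj b a c = Q / sqrt (gram a b c)"
    by (simp_all add: dangle_def gram_commute[of b a] mult.commute P_def Q_def)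
  have "0 - (Ci * a - Cj) * (a * c - b) / (a\<^sup>2 - 1) - (Ci * b - Ck) * (b * c - a) / (b\<^sup>2 - 1)
      = - (P * a + Q * b)"
    unfolding 1 2 P_def Q_def using assms by (simp add: add_divide_distrib diff_divide_distrib)
  then show ?thesis unfolding dP dQ by (simp add: add_divide_distrib diff_divide_distrib)
qed

text \<open>Here the three expressions of the star condition appear literally as coefficients. The
  first summand is strictly positive as long as x y z > -1, which makes the triangle
  nondegenerate.\<close>

lemma gram_expand:
  fixes Si Sj Sk :: real
  assumes C: "Ci\<^sup>2 = 1 + Si\<^sup>2" "Cj\<^sup>2 = 1 + Sj\<^sup>2" "Ck\<^sup>2 = 1 + Sk\<^sup>2"
  shows "gram (Ci * Cj + Si * Sj * x) (Ci * Ck + Si * Sk * y) (Cj * Ck + Sj * Sk * z) =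
    2 * (Si * Sj * Sk)\<^sup>2 * (1 + x * y * z) + (Si * Sj)\<^sup>2 * (1 - x\<^sup>2) + (Si * Sk)\<^sup>2 * (1 - y\<^sup>2)
    + (Sj * Sk)\<^sup>2 * (1 - z\<^sup>2) + 2 * Cj * Ck * Sj * Sk * Si\<^sup>2 * (z + x * y)
    + 2 * Ci * Ck * Si * Sk * Sj\<^sup>2 * (y + x * z) + 2 * Ci * Cj * Si * Sj * Sk\<^sup>2 * (x + y * z)"
  using C unfolding gram_def by algebra

lemma dangle_num_expand:
  fixes Si Sj Sk :: real
  assumes C: "Ci\<^sup>2 = 1 + Si\<^sup>2" "Cj\<^sup>2 = 1 + Sj\<^sup>2" "Ck\<^sup>2 = 1 + Sk\<^sup>2"
  shows "dangle_num Ci Cj Ck (Ci * Cj + Si * Sj * x) (Ci * Ck + Si * Sk * y) (Cj * Ck + Sj * Sk * z) =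
    Ck * (Si * Sj)\<^sup>2 * (1 - x\<^sup>2) + Si\<^sup>2 * Sj * Sk * Cj * (z + x * y) + Sj\<^sup>2 * Si * Sk * Ci * (y + x * z)"
  using C unfolding dangle_num_def by algebra

subsection \<open>Bounds under the star condition\<close>

lemma mult_in_unit_interval:
  fixes x y :: real
  assumes "-1 < x" "x \<le> 1" "-1 < y" "y \<le> 1"
  shows "-1 < x * y" "x * y \<le> 1"
proof -
  have "\<bar>x\<bar> \<le> 1" "\<bar>y\<bar> \<le> 1" using assms by auto
  then have "\<bar>x * y\<bar> \<le> 1" by (simp add: abs_mult mult_le_one)
  then show "x * y \<le> 1" by simp
  have "x * y \<noteq> -1"
  proof
    assume xy: "x * y = -1"
    then have "\<bar>x\<bar> * \<bar>y\<bar> = 1" by (simp flip: abs_mult)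
    then have "\<bar>x\<bar> = 1" "\<bar>y\<bar> = 1"
      using \<open>\<bar>x\<bar> \<le> 1\<close> \<open>\<bar>y\<bar> \<le> 1\<close> mult_left_le[of "\<bar>y\<bar>" "\<bar>x\<bar>"] mult_left_le[of "\<bar>x\<bar>" "\<bar>y\<bar>"]
      by (auto simp: mult.commute)
    then have "x = 1" "y = 1" using assms(1,3) by linarith+
    then show False using xy by simp
  qed
  then show "-1 < x * y" using \<open>\<bar>x * y\<bar> \<le> 1\<close> by simp
qed

text \<open>\<open>x\<close>, \<open>y\<close>, \<open>z\<close> are the cosines of the weights on
  the edges ij, ik, jk; excluding -1 encodes weights below pi.\<close>

locale star_triangle =
  fixes x y z :: real
  assumes x: "-1 < x" "x \<le> 1" and y: "-1 < y" "y \<le> 1" and z: "-1 < z" "z \<le> 1"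
    and star: "0 \<le> x + y * z" "0 \<le> y + x * z" "0 \<le> z + x * y"

text \<open>Each bound keeps a single summand of the expansion. The last one, with C_i C_j >= 1
  discarded, survives tangency and serves the degenerate cases of
  \<open>mixed_term_bound\<close>.\<close>

lemma (in star_triangle) gram_lower:
  fixes Si Sj Sk Ci Cj Ck :: real
  assumes S: "0 < Si" "0 < Sj" "0 < Sk" and C: "1 \<le> Ci" "1 \<le> Cj" "1 \<le> Ck"
    and CS: "Ci\<^sup>2 = 1 + Si\<^sup>2" "Cj\<^sup>2 = 1 + Sj\<^sup>2" "Ck\<^sup>2 = 1 + Sk\<^sup>2"
  defines "G \<equiv> gram (Ci * Cj + Si * Sj * x) (Ci * Ck + Si * Sk * y) (Cj * Ck + Sj * Sk * z)"
  shows "0 < G" "(Si * Sj)\<^sup>2 * (1 - x\<^sup>2) \<le> G" "(Si * Sk)\<^sup>2 * (1 - y\<^sup>2) \<le> G"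
    "(Sj * Sk)\<^sup>2 * (1 - z\<^sup>2) \<le> G" "2 * Si * Sj * Sk\<^sup>2 * (x + y * z) \<le> G"
proof -
  have sq: "0 \<le> 1 - t\<^sup>2" if "-1 < t" "t \<le> 1" for t :: real
    using that by (simp add: abs_square_le_1 abs_le_iff)
  have "-1 < x * y * z"
    using mult_in_unit_interval x y z by auto
  then have 0: "0 < 2 * (Si * Sj * Sk)\<^sup>2 * (1 + x * y * z)"
    using S by (intro mult_pos_pos) auto
  have 1: "0 \<le> (Si * Sj)\<^sup>2 * (1 - x\<^sup>2)" "0 \<le> (Si * Sk)\<^sup>2 * (1 - y\<^sup>2)" "0 \<le> (Sj * Sk)\<^sup>2 * (1 - z\<^sup>2)"
    using sq x y z by auto
  have 2: "0 \<le> 2 * Cj * Ck * Sj * Sk * Si\<^sup>2 * (z + x * y)"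
      "0 \<le> 2 * Ci * Ck * Si * Sk * Sj\<^sup>2 * (y + x * z)"
      "0 \<le> 2 * Ci * Cj * Si * Sj * Sk\<^sup>2 * (x + y * z)"
    using S C star by (auto intro!: mult_nonneg_nonneg)
  have "1 \<le> Ci * Cj" using C mult_mono[of 1 Ci 1 Cj] by simp
  then have "1 * (2 * Si * Sj * Sk\<^sup>2 * (x + y * z)) \<le> Ci * Cj * (2 * Si * Sj * Sk\<^sup>2 * (x + y * z))"
    using S star by (intro mult_right_mono mult_nonneg_nonneg) auto
  then have 3: "2 * Si * Sj * Sk\<^sup>2 * (x + y * z) \<le> 2 * Ci * Cj * Si * Sj * Sk\<^sup>2 * (x + y * z)"
    by (simp add: mult_ac)
  note G = gram_expand[OF CS, of x y z, folded G_def]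
  show "0 < G" "(Si * Sj)\<^sup>2 * (1 - x\<^sup>2) \<le> G" "(Si * Sk)\<^sup>2 * (1 - y\<^sup>2) \<le> G"
    "(Sj * Sk)\<^sup>2 * (1 - z\<^sup>2) \<le> G" "2 * Si * Sj * Sk\<^sup>2 * (x + y * z) \<le> G"
    using 0 1 2 3 unfolding G by linarith+
qed

lemma (in star_triangle) dangle_num_nonneg:
  fixes Si Sj Sk Ci Cj Ck :: real
  assumes S: "0 < Si" "0 < Sj" "0 < Sk" and C: "1 \<le> Ci" "1 \<le> Cj" "1 \<le> Ck"
    and CS: "Ci\<^sup>2 = 1 + Si\<^sup>2" "Cj\<^sup>2 = 1 + Sj\<^sup>2" "Ck\<^sup>2 = 1 + Sk\<^sup>2"
  shows "0 \<le> dangle_num Ci Cj Ck (Ci * Cj + Si * Sj * x) (Ci * Ck + Si * Sk * y) (Cj * Ck + Sj * Sk * z)"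
proof -
  have "0 \<le> 1 - x\<^sup>2" using x by (simp add: abs_square_le_1 abs_le_iff)
  then have "0 \<le> Ck * (Si * Sj)\<^sup>2 * (1 - x\<^sup>2)" "0 \<le> Si\<^sup>2 * Sj * Sk * Cj * (z + x * y)"
      "0 \<le> Sj\<^sup>2 * Si * Sk * Ci * (y + x * z)"
    using S C star by simp_all
  then show ?thesis unfolding dangle_num_expand[OF CS] by (intro add_nonneg_nonneg)
qed

text \<open>When \<open>y < 1\<close> the term $(S_i S_k)^2(1-y^2)$ of the Gram determinant controls the left
side; in the tangential case \<open>y = 1\<close> it vanishes and the mixed term takes over.\<close>

lemma mixed_term_bound:
  fixes y g :: real
  assumes y: "-1 < y" "y \<le> 1" and g: "0 \<le> g" "g \<le> 2"
  shows "\<exists>K\<ge>0. \<forall>Si Sj Sk G. 0 < Si \<longrightarrow> 0 < Sj \<longrightarrow> 0 < Sk \<longrightarrow> (Si * Sk)\<^sup>2 * (1 - y\<^sup>2) \<le> G \<longrightarrow>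
     (y = 1 \<longrightarrow> 2 * Si * Sj * Sk\<^sup>2 * g \<le> G) \<longrightarrow>
     Si\<^sup>2 * Sj * Sk * g \<le> K * (Si\<^sup>2 + Sj\<^sup>2) * sqrt G"
proof (cases "y = 1")
  case True
  have "Si\<^sup>2 * Sj * Sk * g \<le> 1 * (Si\<^sup>2 + Sj\<^sup>2) * sqrt G"
    if S: "0 < Si" "0 < Sj" "0 < Sk" and G: "2 * Si * Sj * Sk\<^sup>2 * g \<le> G" for Si Sj Sk G
  proof -
    have amgm: "Si * Sj \<le> Si\<^sup>2 + Sj\<^sup>2"
      using sum_squares_bound[of Si Sj] S mult_pos_pos[of Si Sj] by linarith
    have G0: "0 \<le> G" by (rule order_trans[OF _ G]) (use S g in auto)
    \<comment> \<open>Squaring isolates exactly one factor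
      \<open>2 * Si * Sj * Sk\<^sup>2 * g\<close>, which is at most \<open>G\<close>; the cofactor
      is free of \<open>Sk\<close>.\<close>
    have "(Si\<^sup>2 * Sj * Sk * g)\<^sup>2 = (Si\<^sup>2 * (Si * Sj) * g / 2) * (2 * Si * Sj * Sk\<^sup>2 * g)"
      by (simp add: power2_eq_square)
    also have "\<dots> \<le> (Si\<^sup>2 * (Si * Sj) * 1) * G"
    proof (rule mult_mono)
      have "Si\<^sup>2 * (Si * Sj) * (g / 2) \<le> Si\<^sup>2 * (Si * Sj) * 1"
        using g S by (intro mult_left_mono) auto
      then show "Si\<^sup>2 * (Si * Sj) * g / 2 \<le> Si\<^sup>2 * (Si * Sj) * 1" by simp
    qed (use G S g in auto)
    also have "\<dots> \<le> (Si\<^sup>2 + Sj\<^sup>2) * (Si\<^sup>2 + Sj\<^sup>2) * G"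
    proof (rule mult_right_mono[OF _ G0])
      show "Si\<^sup>2 * (Si * Sj) * 1 \<le> (Si\<^sup>2 + Sj\<^sup>2) * (Si\<^sup>2 + Sj\<^sup>2)"
        unfolding mult_1_right using amgm S by (intro mult_mono) auto
    qed
    also have "\<dots> = ((Si\<^sup>2 + Sj\<^sup>2) * sqrt G)\<^sup>2"
      using G0 by (simp add: power2_eq_square)
    finally have "Si\<^sup>2 * Sj * Sk * g \<le> (Si\<^sup>2 + Sj\<^sup>2) * sqrt G"
      by (rule power2_le_imp_le) (use G0 in simp)
    then show ?thesis by simp
  qed
  then show ?thesis using True by (intro exI[of _ 1]) auto
next
  case False
  then have "\<bar>y\<bar> < 1" using y by auto
  then have y2: "0 < 1 - y\<^sup>2" by (simp add: abs_square_less_1)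
  \<comment> \<open>This constant degenerates as y tends to 1, which is harmless because
    \<open>y\<close> is fixed, but it forces the separate case y = 1.\<close>
  define K where "K = 2 / sqrt (1 - y\<^sup>2)"
  have "Si\<^sup>2 * Sj * Sk * g \<le> K * (Si\<^sup>2 + Sj\<^sup>2) * sqrt G"
    if S: "0 < Si" "0 < Sj" "0 < Sk" and G: "(Si * Sk)\<^sup>2 * (1 - y\<^sup>2) \<le> G" for Si Sj Sk G
  proof -
    have amgm: "Si * Sj \<le> Si\<^sup>2 + Sj\<^sup>2"
      using sum_squares_bound[of Si Sj] S mult_pos_pos[of Si Sj] by linarith
    have G0: "0 \<le> G" by (rule order_trans[OF _ G]) (use y2 in auto)
    have "Si * Sk * sqrt (1 - y\<^sup>2) = sqrt ((Si * Sk)\<^sup>2 * (1 - y\<^sup>2))"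
      using S by (simp add: real_sqrt_mult)
    also have "\<dots> \<le> sqrt G" using G by simp
    finally have "Si * Sk \<le> sqrt G / sqrt (1 - y\<^sup>2)"
      using y2 by (simp add: pos_le_divide_eq)
    then have "Si * Sj * g * (Si * Sk) \<le> Si * Sj * 2 * (sqrt G / sqrt (1 - y\<^sup>2))"
      using S g by (intro mult_mono) auto
    also have "\<dots> = K * (Si * Sj) * sqrt G" by (simp add: K_def)
    also have "\<dots> \<le> K * (Si\<^sup>2 + Sj\<^sup>2) * sqrt G"
      using amgm G0 y2 by (intro mult_right_mono mult_left_mono) (auto simp: K_def)
    finally show ?thesis by (simp add: power2_eq_square mult_ac)
  qed
  moreover have "0 \<le> K" using y2 by (simp add: K_def)
  ultimately show ?thesis using False by (intro exI[of _ K]) auto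
qed

text \<open>Each of the three summands of the numerator is at most a constant times R (S_i^2 +
  S_j^2) sqrt G, while a^2 - 1 >= d^2 (S_i^2 + S_j^2). These factors cancel, so no lower bound on
  the radii enters, and \<open>K\<close> depends on the weights only.\<close>

lemma (in star_triangle) dangle_bound:
  "\<exists>K\<ge>0. \<forall>Si Sj Sk Ci Cj Ck R. 0 < Si \<longrightarrow> 0 < Sj \<longrightarrow> 0 < Sk \<longrightarrow>
     1 \<le> Ci \<longrightarrow> 1 \<le> Cj \<longrightarrow> 1 \<le> Ck \<longrightarrow>
     Ci\<^sup>2 = 1 + Si\<^sup>2 \<longrightarrow> Cj\<^sup>2 = 1 + Sj\<^sup>2 \<longrightarrow> Ck\<^sup>2 = 1 + Sk\<^sup>2 \<longrightarrow>
     Ci \<le> R \<longrightarrow> Cj \<le> R \<longrightarrow> Ck \<le> R \<longrightarrow>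
     dangle Ci Cj Ck (Ci * Cj + Si * Sj * x) (Ci * Ck + Si * Sk * y) (Cj * Ck + Sj * Sk * z) \<le> K * R"
proof -
  have le2: "x + y * z \<le> 2" "y + x * z \<le> 2" "z + x * y \<le> 2"
    using x y z mult_in_unit_interval[of x y] mult_in_unit_interval[of x z] mult_in_unit_interval[of y z]
    by linarith+
  obtain K1 where K1: "K1 \<ge> 0" "\<And>Si Sj Sk G. 0 < Si \<Longrightarrow> 0 < Sj \<Longrightarrow> 0 < Sk \<Longrightarrow>
      (Si * Sk)\<^sup>2 * (1 - y\<^sup>2) \<le> G \<Longrightarrow> (y = 1 \<Longrightarrow> 2 * Si * Sj * Sk\<^sup>2 * (z + x * y) \<le> G) \<Longrightarrow>
      Si\<^sup>2 * Sj * Sk * (z + x * y) \<le> K1 * (Si\<^sup>2 + Sj\<^sup>2) * sqrt G"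
    using mixed_term_bound[OF y star(3) le2(3)] by blast
  obtain K2 where K2: "K2 \<ge> 0" "\<And>Sj Si Sk G. 0 < Sj \<Longrightarrow> 0 < Si \<Longrightarrow> 0 < Sk \<Longrightarrow>
      (Sj * Sk)\<^sup>2 * (1 - z\<^sup>2) \<le> G \<Longrightarrow> (z = 1 \<Longrightarrow> 2 * Sj * Si * Sk\<^sup>2 * (y + x * z) \<le> G) \<Longrightarrow>
      Sj\<^sup>2 * Si * Sk * (y + x * z) \<le> K2 * (Sj\<^sup>2 + Si\<^sup>2) * sqrt G"
    using mixed_term_bound[OF z star(2) le2(2)] by blast
  define d where "d = min 1 (1 + x)"
  have d: "0 < d" "d \<le> 1" "d \<le> 1 + x" using x by (auto simp: d_def)
  define K where "K = (1 + K1 + K2) / d\<^sup>2"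
  have "dangle Ci Cj Ck (Ci * Cj + Si * Sj * x) (Ci * Ck + Si * Sk * y) (Cj * Ck + Sj * Sk * z) \<le> K * R"
    if S: "0 < Si" "0 < Sj" "0 < Sk" and C: "1 \<le> Ci" "1 \<le> Cj" "1 \<le> Ck"
    and CS: "Ci\<^sup>2 = 1 + Si\<^sup>2" "Cj\<^sup>2 = 1 + Sj\<^sup>2" "Ck\<^sup>2 = 1 + Sk\<^sup>2"
    and R: "Ci \<le> R" "Cj \<le> R" "Ck \<le> R" for Si Sj Sk Ci Cj Ck R
  proof -
    define a where "a = Ci * Cj + Si * Sj * x"
    define G where "G = gram (Ci * Cj + Si * Sj * x) (Ci * Ck + Si * Sk * y) (Cj * Ck + Sj * Sk * z)"
    note low = gram_lower[OF S C CS, folded G_def]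
    define Q where "Q = Si\<^sup>2 + Sj\<^sup>2"
    have Q: "0 < Q" using S by (simp add: Q_def add_pos_pos)
    have amgm: "Si * Sj \<le> Q"
      using sum_squares_bound[of Si Sj] S mult_pos_pos[of Si Sj] unfolding Q_def by linarith
    \<comment> \<open>Algebraic form of cosh(r_i - r_j) >= 1.\<close>
    have "(1 + Si * Sj)\<^sup>2 \<le> (Ci * Cj)\<^sup>2"
      unfolding power_mult_distrib CS using sum_squares_bound[of Si Sj]
      by (simp add: power2_eq_square algebra_simps)
    then have CC: "1 + Si * Sj \<le> Ci * Cj"
      by (rule power2_le_imp_le) (use C in auto)
    have "(1 - d) * 1 \<le> (1 - d) * (Ci * Cj - Si * Sj)"
      using CC d by (intro mult_left_mono) auto
    moreover have "Si * Sj * (d - 1) \<le> Si * Sj * x" using d S by (intro mult_left_mono) auto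
    ultimately have a: "d * (Ci * Cj) + (1 - d) \<le> a" by (simp add: a_def algebra_simps)
    have "1 \<le> Ci * Cj" using CC mult_pos_pos[OF S(1,2)] by linarith
    have "d * 1 \<le> d * (Ci * Cj)" using d \<open>1 \<le> Ci * Cj\<close> by (intro mult_left_mono) auto
    then have "1 \<le> a" using a by linarith
    have "0 \<le> d * (Ci * Cj + 1)" using d \<open>1 \<le> Ci * Cj\<close> by simp
    \<comment> \<open>Factoring a^2 - 1 allows a - 1 >= d (C_i C_j - 1) and a + 1 >= d (C_i C_j + 1)
      to be multiplied; the product d^2 (C_i^2 C_j^2 - 1) dominates d^2 (S_i^2 + S_j^2).\<close>
    then have "(d * (Ci * Cj - 1)) * (d * (Ci * Cj + 1)) \<le> (a - 1) * (a + 1)"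
      using a d \<open>1 \<le> a\<close> by (intro mult_mono) (auto simp: algebra_simps)
    moreover have "(d * (Ci * Cj - 1)) * (d * (Ci * Cj + 1)) = d\<^sup>2 * (Ci\<^sup>2 * Cj\<^sup>2 - 1)"
      by (simp add: power2_eq_square algebra_simps)
    moreover have "d\<^sup>2 * Q \<le> d\<^sup>2 * (Ci\<^sup>2 * Cj\<^sup>2 - 1)"
      unfolding CS Q_def using d by (intro mult_left_mono) (auto simp: algebra_simps)
    ultimately have a2: "d\<^sup>2 * Q \<le> a\<^sup>2 - 1"
      by (simp add: power2_eq_square algebra_simps)
    then have a20: "0 < a\<^sup>2 - 1" using Q d by (intro less_le_trans[OF _ a2]) auto
    have x2: "0 \<le> 1 - x\<^sup>2" "1 - x\<^sup>2 \<le> 1" using x by (auto simp: abs_square_le_1 abs_le_iff)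
    have T1: "(Si * Sj)\<^sup>2 * (1 - x\<^sup>2) \<le> Q * sqrt G"
    proof -
      have "((Si * Sj)\<^sup>2 * (1 - x\<^sup>2))\<^sup>2 = ((Si * Sj)\<^sup>2 * (1 - x\<^sup>2)) * ((Si * Sj)\<^sup>2 * (1 - x\<^sup>2))"
        by (simp add: power2_eq_square)
      also have "\<dots> \<le> (Q\<^sup>2 * 1) * G"
        using low(2) x2 amgm S by (intro mult_mono power_mono) auto
      also have "\<dots> = (Q * sqrt G)\<^sup>2" using low(1) by (simp add: power_mult_distrib)
      finally show ?thesis
        by (rule power2_le_imp_le) (use Q low(1) in auto)
    qed
    \<comment> \<open>If y = 1 then z + x y and x + y z coincide, so the last clause of
      \<open>gram_lower\<close> supplies the tangential premise. In \<open>T3\<close> the same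
      happens for z = 1 with y + x z.\<close>
    have T2: "Si\<^sup>2 * Sj * Sk * (z + x * y) \<le> K1 * Q * sqrt G"
      unfolding Q_def using S low by (intro K1(2)) (auto simp: add.commute)
    have T3: "Sj\<^sup>2 * Si * Sk * (y + x * z) \<le> K2 * Q * sqrt G"
      unfolding Q_def add.commute[of "Si\<^sup>2"] using S low by (intro K2(2)) (auto simp: mult_ac add.commute)
    have "dangle_num Ci Cj Ck (Ci * Cj + Si * Sj * x) (Ci * Ck + Si * Sk * y) (Cj * Ck + Sj * Sk * z)
      = Ck * ((Si * Sj)\<^sup>2 * (1 - x\<^sup>2)) + Cj * (Si\<^sup>2 * Sj * Sk * (z + x * y))
        + Ci * (Sj\<^sup>2 * Si * Sk * (y + x * z))"
      unfolding dangle_num_expand[OF CS] by (simp add: mult_ac)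
    also have "\<dots> \<le> R * (Q * sqrt G) + R * (K1 * Q * sqrt G) + R * (K2 * Q * sqrt G)"
    proof (intro add_mono)
      show "Ck * ((Si * Sj)\<^sup>2 * (1 - x\<^sup>2)) \<le> R * (Q * sqrt G)"
        by (rule mult_mono[OF R(3) T1]) (use R C x2 in auto)
      show "Cj * (Si\<^sup>2 * Sj * Sk * (z + x * y)) \<le> R * (K1 * Q * sqrt G)"
        by (rule mult_mono[OF R(2) T2]) (use R C S star in auto)
      show "Ci * (Sj\<^sup>2 * Si * Sk * (y + x * z)) \<le> R * (K2 * Q * sqrt G)"
        by (rule mult_mono[OF R(1) T3]) (use R C S star in auto)
    qed
    also have "\<dots> = K * R * sqrt G * (d\<^sup>2 * Q)"
      using d by (simp add: K_def field_simps)
    also have "\<dots> \<le> K * R * sqrt G * (a\<^sup>2 - 1)"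
      using a2 K1(1) K2(1) C R low(1) by (intro mult_left_mono) (auto simp: K_def)
    finally have "dangle_num Ci Cj Ck (Ci * Cj + Si * Sj * x) (Ci * Ck + Si * Sk * y) (Cj * Ck + Sj * Sk * z)
      \<le> K * R * (sqrt G * (a\<^sup>2 - 1))" by (simp add: mult_ac)
    then show ?thesis
      unfolding dangle_def G_def[symmetric] unfolding a_def[symmetric]
      using a20 low(1) by (simp add: pos_divide_le_eq)
  qed
  moreover have "0 \<le> K" using K1 K2 by (simp add: K_def)
  ultimately show ?thesis by (intro exI[of _ K]) blast
qed

subsection \<open>Angles as functions of the radii\<close>

lemma angle_commute: "\<Phi> j k = \<Phi> k j \<Longrightarrow> angle \<Phi> u i j k = angle \<Phi> u i k j"
  by (simp add: angle_def elen_def mult_ac)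

text \<open>The two \<open>SOME\<close> choices can only order the remaining vertices in two ways,
  and symmetry of the weight makes both give the same angle.\<close>

lemma corner_angle_eq:
  assumes "i \<noteq> j" "i \<noteq> k" "j \<noteq> k" "\<Phi> j k = \<Phi> k j"
  shows "corner_angle \<Phi> u i {i, j, k} = angle \<Phi> u i j k"
proof -
  define m where "m = (SOME m. m \<in> {i, j, k} - {i})"
  have "m \<in> {i, j, k} - {i}" unfolding m_def by (rule someI[of _ j]) (use assms in auto)
  then consider "m = j" | "m = k" by auto
  then show ?thesis
  proof cases
    case 1
    have "(SOME n. n \<in> {i, j, k} - {i, m}) = k" using 1 assms by (intro some_equality) auto
    then show ?thesis unfolding corner_angle_def Let_def m_def[symmetric] using 1 by simp
  next
    case 2
    have "(SOME n. n \<in> {i, j, k} - {i, m}) = j" using 2 assms by (intro some_equality) auto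
    then show ?thesis
      unfolding corner_angle_def Let_def m_def[symmetric] using 2 angle_commute[of \<Phi> j k u i] assms(4) by simp
  qed
qed

definition tri_dangle :: "('v \<Rightarrow> 'v \<Rightarrow> real) \<Rightarrow> ('v \<Rightarrow> real) \<Rightarrow> 'v \<Rightarrow> 'v \<Rightarrow> 'v \<Rightarrow> real" where
  "tri_dangle \<Phi> u i j k = dangle (cosh (radius (u i))) (cosh (radius (u j))) (cosh (radius (u k)))
     (edge_cosh \<Phi> u i j) (edge_cosh \<Phi> u i k) (edge_cosh \<Phi> u j k)"

locale circle_packing_triangle =
  fixes \<Phi> :: "'v \<Rightarrow> 'v \<Rightarrow> real" and i j k :: 'v
  assumes distinct: "i \<noteq> j" "i \<noteq> k" "j \<noteq> k"
    and sym: "\<Phi> i j = \<Phi> j i" "\<Phi> i k = \<Phi> k i" "\<Phi> j k = \<Phi> k j"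
    and star_triangle: "star_triangle (cos (\<Phi> i j)) (cos (\<Phi> i k)) (cos (\<Phi> j k))"
begin

interpretation star_triangle "cos (\<Phi> i j)" "cos (\<Phi> i k)" "cos (\<Phi> j k)"
  by (rule star_triangle)

lemma edge_cosh_gt:
  assumes "u i < 0" "u j < 0" "u k < 0"
  shows "1 < edge_cosh \<Phi> u i j" "1 < edge_cosh \<Phi> u i k" "1 < edge_cosh \<Phi> u j k"
  using edge_cosh_gt_1 x y z assms by auto

lemma edge_cosh_sq_gt:
  assumes "u i < 0" "u j < 0" "u k < 0"
  shows "1 < (edge_cosh \<Phi> u i j)\<^sup>2" "1 < (edge_cosh \<Phi> u i k)\<^sup>2"
  using edge_cosh_gt[of u] assms by (simp_all add: one_less_power)

lemma gram_pos:
  assumes "u i < 0" "u j < 0" "u k < 0"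
  shows "0 < gram (edge_cosh \<Phi> u i j) (edge_cosh \<Phi> u i k) (edge_cosh \<Phi> u j k)"
  unfolding edge_cosh_def
  by (rule gram_lower) (use assms in \<open>auto simp: radius_pos cosh_real_ge_1 cosh_square_eq\<close>)

lemma angle_eq:
  assumes "u i < 0" "u j < 0" "u k < 0"
  shows "angle \<Phi> u i j k = arccos ((edge_cosh \<Phi> u i j * edge_cosh \<Phi> u i k - edge_cosh \<Phi> u j k)
      / (sqrt ((edge_cosh \<Phi> u i j)\<^sup>2 - 1) * sqrt ((edge_cosh \<Phi> u i k)\<^sup>2 - 1)))"
  unfolding angle_def using edge_cosh_gt[of u] assms by (simp add: cosh_elen sinh_elen)

text \<open>Positivity of the Gram determinant says that sin^2 theta_i > 0. Strictness keeps
  \<open>arccos\<close> in the interior of its domain, where it is differentiable.\<close>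

lemma cos_law_abs_less_1:
  assumes "u i < 0" "u j < 0" "u k < 0"
  shows "\<bar>(edge_cosh \<Phi> u i j * edge_cosh \<Phi> u i k - edge_cosh \<Phi> u j k)
      / (sqrt ((edge_cosh \<Phi> u i j)\<^sup>2 - 1) * sqrt ((edge_cosh \<Phi> u i k)\<^sup>2 - 1))\<bar> < 1"
proof -
  let ?a = "edge_cosh \<Phi> u i j" and ?b = "edge_cosh \<Phi> u i k" and ?c = "edge_cosh \<Phi> u j k"
  have pos: "0 < sqrt (?a\<^sup>2 - 1) * sqrt (?b\<^sup>2 - 1)" using edge_cosh_sq_gt[OF assms] by simp
  have "(?a * ?b - ?c)\<^sup>2 < (?a\<^sup>2 - 1) * (?b\<^sup>2 - 1)"
    using gram_pos[OF assms] unfolding gram_eq_diff by simp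
  also have "\<dots> = (sqrt (?a\<^sup>2 - 1) * sqrt (?b\<^sup>2 - 1))\<^sup>2"
    using edge_cosh_sq_gt[OF assms] by (simp add: power_mult_distrib)
  finally have "\<bar>?a * ?b - ?c\<bar>\<^sup>2 < (sqrt (?a\<^sup>2 - 1) * sqrt (?b\<^sup>2 - 1))\<^sup>2"
    by simp
  then have "\<bar>?a * ?b - ?c\<bar> < sqrt (?a\<^sup>2 - 1) * sqrt (?b\<^sup>2 - 1)"
    by (rule power2_less_imp_less) (use pos in auto)
  then show ?thesis using pos unfolding abs_divide abs_of_pos[OF pos] by simp
qed

lemma angle_nonneg:
  assumes "u i < 0" "u j < 0" "u k < 0"
  shows "0 \<le> angle \<Phi> u i j k"
  unfolding angle_eq[OF assms] using cos_law_abs_less_1[OF assms] unfolding abs_less_iff by (intro arccos_lbound) linarith+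

lemma angle_le_pi:
  assumes "u i < 0" "u j < 0" "u k < 0"
  shows "angle \<Phi> u i j k \<le> pi"
  unfolding angle_eq[OF assms] using cos_law_abs_less_1[OF assms] unfolding abs_less_iff by (intro arccos_ubound) linarith+

lemma angle_deriv_neighbour:
  assumes u: "u i < 0" "u j < 0" "u k < 0"
  shows "((\<lambda>x. angle \<Phi> (u(j := x)) i j k) has_real_derivative tri_dangle \<Phi> u i j k) (at (u j))"
proof -
  have sq: "(edge_cosh \<Phi> u i j)\<^sup>2 \<noteq> 1" "(edge_cosh \<Phi> u i k)\<^sup>2 \<noteq> 1"
    using edge_cosh_sq_gt[OF u] by auto
  let ?e = "\<lambda>x. edge_cosh \<Phi> (u(j := x))"
  have "((\<lambda>x. arccos ((?e x i j * ?e x i k - ?e x j k) / (sqrt ((?e x i j)\<^sup>2 - 1) * sqrt ((?e x i k)\<^sup>2 - 1))))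
      has_real_derivative tri_dangle \<Phi> u i j k) (at (u j))"
  proof (rule DERIV_cong[OF cos_law_has_real_derivative])
    show "((\<lambda>x. ?e x i j) has_real_derivative
        cosh (radius (u j)) * edge_cosh \<Phi> u i j - cosh (radius (u i))) (at (u j))"
      using distinct u by (intro edge_cosh_deriv_right) auto
    show "((\<lambda>x. ?e x i k) has_real_derivative 0) (at (u j))"
      using distinct by (simp add: edge_cosh_def)
    show "((\<lambda>x. ?e x j k) has_real_derivative
        cosh (radius (u j)) * edge_cosh \<Phi> u j k - cosh (radius (u k))) (at (u j))"
      using distinct u by (intro edge_cosh_deriv_left) auto
  qed (use edge_cosh_gt[OF u] gram_pos[OF u] dangle_eq_neighbour[OF sq(1),
      of "cosh (radius (u j))" _ "cosh (radius (u k))" "cosh (radius (u i))"] in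
      \<open>simp_all add: tri_dangle_def\<close>)
  \<comment> \<open>The cosine-law form of the angle is available only for negative coordinates, so
    the derivative is transferred on a neighbourhood where \<open>x\<close> stays negative.\<close>
  moreover have "\<forall>\<^sub>F x in nhds (u j). x < 0"
    using eventually_nhds_in_open[OF open_lessThan, of "u j" 0] u by simp
  then have "\<forall>\<^sub>F x in nhds (u j). angle \<Phi> (u(j := x)) i j k =
      arccos ((?e x i j * ?e x i k - ?e x j k) / (sqrt ((?e x i j)\<^sup>2 - 1) * sqrt ((?e x i k)\<^sup>2 - 1)))"
    by eventually_elim (use u in \<open>auto intro!: angle_eq\<close>)
  ultimately show ?thesis by (subst DERIV_cong_ev[OF refl _ refl])
qed

lemma angle_deriv_apex:
  assumes u: "u i < 0" "u j < 0" "u k < 0"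
  shows "((\<lambda>x. angle \<Phi> (u(i := x)) i j k) has_real_derivative
    - (tri_dangle \<Phi> u i j k * edge_cosh \<Phi> u i j + tri_dangle \<Phi> u i k j * edge_cosh \<Phi> u i k)) (at (u i))"
proof -
  have sq: "(edge_cosh \<Phi> u i j)\<^sup>2 \<noteq> 1" "(edge_cosh \<Phi> u i k)\<^sup>2 \<noteq> 1"
    using edge_cosh_sq_gt[OF u] by auto
  let ?e = "\<lambda>x. edge_cosh \<Phi> (u(i := x))"
  have "((\<lambda>x. arccos ((?e x i j * ?e x i k - ?e x j k) / (sqrt ((?e x i j)\<^sup>2 - 1) * sqrt ((?e x i k)\<^sup>2 - 1))))
      has_real_derivative
      - (tri_dangle \<Phi> u i j k * edge_cosh \<Phi> u i j + tri_dangle \<Phi> u i k j * edge_cosh \<Phi> u i k)) (at (u i))"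
  proof (rule DERIV_cong[OF cos_law_has_real_derivative])
    show "((\<lambda>x. ?e x i j) has_real_derivative
        cosh (radius (u i)) * edge_cosh \<Phi> u i j - cosh (radius (u j))) (at (u i))"
      using distinct u by (intro edge_cosh_deriv_left) auto
    show "((\<lambda>x. ?e x i k) has_real_derivative
        cosh (radius (u i)) * edge_cosh \<Phi> u i k - cosh (radius (u k))) (at (u i))"
      using distinct u by (intro edge_cosh_deriv_left) auto
    show "((\<lambda>x. ?e x j k) has_real_derivative 0) (at (u i))"
      using distinct by (simp add: edge_cosh_def)
  qed (use edge_cosh_gt[OF u] gram_pos[OF u] edge_cosh_commute[of \<Phi> k j u] sym dangle_eq_apex[OF sq,
      of "cosh (radius (u i))" "cosh (radius (u j))" _ "cosh (radius (u k))"] in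
      \<open>simp_all add: tri_dangle_def\<close>)
  moreover have "\<forall>\<^sub>F x in nhds (u i). x < 0"
    using eventually_nhds_in_open[OF open_lessThan, of "u i" 0] u by simp
  then have "\<forall>\<^sub>F x in nhds (u i). angle \<Phi> (u(i := x)) i j k =
      arccos ((?e x i j * ?e x i k - ?e x j k) / (sqrt ((?e x i j)\<^sup>2 - 1) * sqrt ((?e x i k)\<^sup>2 - 1)))"
    by eventually_elim (use u in \<open>auto intro!: angle_eq\<close>)
  ultimately show ?thesis by (subst DERIV_cong_ev[OF refl _ refl])
qed

lemma tri_dangle_commute: "tri_dangle \<Phi> u i j k = tri_dangle \<Phi> u j i k"
  unfolding tri_dangle_def dangle_commute[of "cosh (radius (u j))"]
  using edge_cosh_commute[of \<Phi> i j u] sym by simp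

lemma tri_dangle_nonneg:
  assumes "u i < 0" "u j < 0" "u k < 0"
  shows "0 \<le> tri_dangle \<Phi> u i j k"
proof -
  have "0 \<le> dangle_num (cosh (radius (u i))) (cosh (radius (u j))) (cosh (radius (u k)))
     (edge_cosh \<Phi> u i j) (edge_cosh \<Phi> u i k) (edge_cosh \<Phi> u j k)"
    unfolding edge_cosh_def
    by (rule dangle_num_nonneg) (use assms in \<open>auto simp: radius_pos cosh_real_ge_1 cosh_square_eq\<close>)
  then show ?thesis
    unfolding tri_dangle_def dangle_def
    using gram_pos[OF assms] edge_cosh_sq_gt[OF assms] by (intro divide_nonneg_pos mult_pos_pos) auto
qed

text \<open>The only effect of u <= M is cosh r <= cosh (\<open>radius M\<close>), which plays the
  role of \<open>R\<close> in \<open>dangle_bound\<close>.\<close>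

lemma tri_dangle_bounded:
  assumes "M < 0"
  shows "\<exists>K\<ge>0. \<forall>u. u i \<le> M \<longrightarrow> u j \<le> M \<longrightarrow> u k \<le> M \<longrightarrow> tri_dangle \<Phi> u i j k \<le> K"
proof -
  obtain K where K: "K \<ge> 0" "\<And>Si Sj Sk Ci Cj Ck R. 0 < Si \<Longrightarrow> 0 < Sj \<Longrightarrow> 0 < Sk \<Longrightarrow>
     1 \<le> Ci \<Longrightarrow> 1 \<le> Cj \<Longrightarrow> 1 \<le> Ck \<Longrightarrow>
     Ci\<^sup>2 = 1 + Si\<^sup>2 \<Longrightarrow> Cj\<^sup>2 = 1 + Sj\<^sup>2 \<Longrightarrow> Ck\<^sup>2 = 1 + Sk\<^sup>2 \<Longrightarrow>
     Ci \<le> R \<Longrightarrow> Cj \<le> R \<Longrightarrow> Ck \<le> R \<Longrightarrow>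
     dangle Ci Cj Ck (Ci * Cj + Si * Sj * cos (\<Phi> i j)) (Ci * Ck + Si * Sk * cos (\<Phi> i k))
       (Cj * Ck + Sj * Sk * cos (\<Phi> j k)) \<le> K * R"
    using dangle_bound by blast
  show ?thesis
  proof (intro exI[of _ "K * cosh (radius M)"] conjI allI impI)
    show "0 \<le> K * cosh (radius M)" using K(1) by simp
    fix u assume u: "u i \<le> M" "u j \<le> M" "u k \<le> M"
    then have "u i < 0" "u j < 0" "u k < 0" using assms by auto
    then show "tri_dangle \<Phi> u i j k \<le> K * cosh (radius M)"
      unfolding tri_dangle_def edge_cosh_def
      by (intro K(2)) (use u assms in
        \<open>auto simp: radius_pos cosh_real_ge_1 cosh_square_eq intro: cosh_radius_mono\<close>)
  qed
qed

text \<open>A large circle makes its own angle small: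
$1 - \cos\theta_i \le \cosh l_{jk} / (\sinh l_{ij} \sinh l_{ik})$.\<close>

lemma angle_small:
  assumes u: "u i < 0" "u j < 0" "u k < 0"
    and d: "0 < d" "d \<le> 1" "d \<le> 1 + cos (\<Phi> i j)" "d \<le> 1 + cos (\<Phi> i k)"
    and large: "2 \<le> d * cosh (radius (u i))" "8 \<le> (1 - cos \<epsilon>) * (d * cosh (radius (u i)))\<^sup>2"
    and \<epsilon>: "0 \<le> \<epsilon>" "\<epsilon> \<le> pi"
  shows "angle \<Phi> u i j k \<le> \<epsilon>"
proof -
  define a b c where "a = edge_cosh \<Phi> u i j" and "b = edge_cosh \<Phi> u i k" and "c = edge_cosh \<Phi> u j k"
  define X Cj Ck where "X = d * cosh (radius (u i))" and "Cj = cosh (radius (u j))"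
    and "Ck = cosh (radius (u k))"
  have C: "1 \<le> Cj" "1 \<le> Ck" by (simp_all add: Cj_def Ck_def cosh_real_ge_1)
  have a: "X * Cj \<le> a" using edge_cosh_ge[of d \<Phi> i j u] d u by (simp add: a_def X_def Cj_def)
  have b: "X * Ck \<le> b" using edge_cosh_ge[of d \<Phi> i k u] d u by (simp add: b_def X_def Ck_def)
  have X: "2 \<le> X" "8 \<le> (1 - cos \<epsilon>) * X\<^sup>2" using large by (simp_all add: X_def)
  \<comment> \<open>Origin of the constants 2 and 8: s >= 2 gives sqrt(s^2 - 1) >= s/2, so the
    denominator of the cosine law is at least X^2 C_j C_k / 4, while c <= 2 C_j C_k. Their ratio is
    at most 8 / X^2.\<close>
  have sh: "X * t / 2 \<le> sqrt (s\<^sup>2 - 1)" if "X * t \<le> s" "1 \<le> t" for s t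
  proof (rule real_le_rsqrt)
    have "2 * 1 \<le> X * t" using X that by (intro mult_mono) auto
    then have "2 \<le> s" using that by simp
    have "4 \<le> s\<^sup>2" using power_mono[OF \<open>2 \<le> s\<close>, of 2] by simp
    have "(X * t / 2)\<^sup>2 \<le> (s / 2)\<^sup>2"
      using that \<open>2 * 1 \<le> X * t\<close> by (intro power_mono) auto
    also have "\<dots> \<le> s\<^sup>2 - 1" using \<open>4 \<le> s\<^sup>2\<close> by (simp add: power_divide)
    finally show "(X * t / 2)\<^sup>2 \<le> s\<^sup>2 - 1" .
  qed
  define P where "P = sqrt (a\<^sup>2 - 1) * sqrt (b\<^sup>2 - 1)"
  have "(X * Cj / 2) * (X * Ck / 2) \<le> P"
    unfolding P_def using sh[OF a C(1)] sh[OF b C(2)] X C edge_cosh_sq_gt[OF u, folded a_def b_def]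
    by (intro mult_mono) auto
  then have P: "X\<^sup>2 * (Cj * Ck) / 4 \<le> P" by (simp add: power2_eq_square mult_ac)
  have P0: "0 < P" by (rule less_le_trans[OF _ P]) (use X C in auto)
  have c: "c \<le> 2 * Cj * Ck" using edge_cosh_le[of u j k \<Phi>] u by (simp add: c_def Cj_def Ck_def)
  have "8 * (Cj * Ck) \<le> (1 - cos \<epsilon>) * X\<^sup>2 * (Cj * Ck)"
    using X C by (intro mult_right_mono) auto
  also have "\<dots> = (1 - cos \<epsilon>) * (4 * (X\<^sup>2 * (Cj * Ck) / 4))" by simp
  also have "\<dots> \<le> (1 - cos \<epsilon>) * (4 * P)"
    using P by (intro mult_left_mono) auto
  finally have cP: "c \<le> (1 - cos \<epsilon>) * P" using c by (simp add: algebra_simps)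
  have "P \<le> a * b"
    unfolding P_def using a b X C edge_cosh_gt[OF u]
    by (intro mult_mono real_le_lsqrt) (auto simp: a_def b_def)
  then have "P - (1 - cos \<epsilon>) * P \<le> a * b - c" using cP by simp
  then have "cos \<epsilon> * P \<le> a * b - c" by (simp add: algebra_simps)
  then have "cos \<epsilon> \<le> (a * b - c) / P" using P0 by (simp add: pos_le_divide_eq)
  then have "arccos ((a * b - c) / P) \<le> arccos (cos \<epsilon>)"
    using cos_law_abs_less_1[OF u] by (intro arccos_le_mono[THEN iffD2]) (auto simp: a_def b_def c_def P_def)
  then show ?thesis
    unfolding angle_eq[OF u] using \<epsilon> by (simp add: arccos_cos a_def b_def c_def P_def)
qed

end

subsection \<open>Curvature and the coefficients of the flow\<close>

definition face_dangle :: "('v \<Rightarrow> 'v \<Rightarrow> real) \<Rightarrow> ('v \<Rightarrow> real) \<Rightarrow> 'v set \<Rightarrow> 'v \<Rightarrow> 'v \<Rightarrow> real" where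
  "face_dangle \<Phi> u f i j = deriv (\<lambda>x. corner_angle \<Phi> (u(j := x)) i f) (u j)"

lemma Bcoef_eq: "Bcoef F \<Phi> u i j = (\<Sum>f\<in>{f\<in>F. i \<in> f \<and> j \<in> f}. face_dangle \<Phi> u f i j)"
  by (simp add: Bcoef_def face_dangle_def)

locale weighted_triangulation =
  fixes F :: "'v::finite set set" and \<Phi> :: "'v \<Rightarrow> 'v \<Rightarrow> real"
  assumes triangulation: "closed_surface_triangulation F"
    and weight: "weight F \<Phi>"
    and star: "star_condition F \<Phi>"
begin

lemma face_vertices:
  assumes "f \<in> F" "i \<in> f" "j \<in> f" "i \<noteq> j"
  obtains k where "f = {i, j, k}" "i \<noteq> k" "j \<noteq> k"
proof -
  have "card f = 3" using triangulation assms by (auto simp: closed_surface_triangulation_def)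
  then have "card (f - {i, j}) = 1" using assms by (subst card_Diff_subset) auto
  then obtain k where "f - {i, j} = {k}" by (rule card_1_singletonE)
  then have "f = {i, j, k}" "i \<noteq> k" "j \<noteq> k" using assms by auto
  then show thesis by (rule that)
qed

lemma face_corner:
  assumes "f \<in> F" "i \<in> f"
  obtains j k where "f = {i, j, k}" "i \<noteq> j" "i \<noteq> k" "j \<noteq> k"
proof -
  have "card f = 3" using triangulation assms by (auto simp: closed_surface_triangulation_def)
  then have "card (f - {i}) = 2" using assms by simp
  then obtain j where j: "j \<in> f" "i \<noteq> j" by (metis DiffE card.empty ex_in_conv insertI1 zero_neq_numeral)
  obtain k where "f = {i, j, k}" "i \<noteq> k" "j \<noteq> k" using face_vertices[OF assms j] .
  then show thesis using j(2) by (intro that)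
qed

lemma adjacent_iff: "adjacent F i j \<longleftrightarrow> i \<noteq> j \<and> (\<exists>f\<in>F. i \<in> f \<and> j \<in> f)"
  unfolding adjacent_def edges_def by (auto simp: card_insert_if)

lemma cos_weight_gt: "adjacent F i j \<Longrightarrow> -1 < cos (\<Phi> i j)"
  using weight cos_monotone_0_pi[of "\<Phi> i j" pi] by (auto simp: weight_def)

lemma weight_sym: "adjacent F i j \<Longrightarrow> \<Phi> i j = \<Phi> j i"
  by (rule weight[unfolded weight_def, rule_format, THEN conjunct1])

lemma triangle:
  assumes "{i, j, k} \<in> F" "i \<noteq> j" "i \<noteq> k" "j \<noteq> k"
  shows "circle_packing_triangle \<Phi> i j k"
proof -
  have adj: "adjacent F i j" "adjacent F i k" "adjacent F j k"
    unfolding adjacent_iff using assms(2-4)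
    by (intro conjI bexI[OF _ assms(1)]; simp)+
  have "\<Phi> i j = \<Phi> j i" "\<Phi> i k = \<Phi> k i" "\<Phi> j k = \<Phi> k j"
    by (simp_all only: adj[THEN weight_sym])
  moreover have "star_triangle (cos (\<Phi> i j)) (cos (\<Phi> i k)) (cos (\<Phi> j k))"
  proof
    show "0 \<le> cos (\<Phi> i j) + cos (\<Phi> i k) * cos (\<Phi> j k)"
        "0 \<le> cos (\<Phi> i k) + cos (\<Phi> i j) * cos (\<Phi> j k)"
        "0 \<le> cos (\<Phi> j k) + cos (\<Phi> i j) * cos (\<Phi> i k)"
      using star assms(1) unfolding star_condition_def Let_def by blast+
  qed (use adj[THEN cos_weight_gt] in auto)
  ultimately show ?thesis using assms(2-4) by (intro circle_packing_triangle.intro)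
qed

lemma corner_angle_triangle:
  assumes "{i, j, k} \<in> F" "i \<noteq> j" "i \<noteq> k" "j \<noteq> k"
  shows "corner_angle \<Phi> u i {i, j, k} = angle \<Phi> u i j k"
  by (rule corner_angle_eq[OF assms(2-4) circle_packing_triangle.sym(3)[OF triangle[OF assms]]])

lemma corner_angle_deriv:
  assumes f: "{i, j, k} \<in> F" "i \<noteq> j" "i \<noteq> k" "j \<noteq> k" and u: "\<And>v. u v < 0"
  shows "((\<lambda>x. corner_angle \<Phi> (u(j := x)) i {i, j, k}) has_real_derivative tri_dangle \<Phi> u i j k) (at (u j))"
  unfolding corner_angle_triangle[OF f]
  by (rule circle_packing_triangle.angle_deriv_neighbour[OF triangle[OF f]]) (rule u)+

lemma face_dangle_eq:
  assumes "{i, j, k} \<in> F" "i \<noteq> j" "i \<noteq> k" "j \<noteq> k" and "\<And>v. u v < 0"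
  shows "face_dangle \<Phi> u {i, j, k} i j = tri_dangle \<Phi> u i j k"
  unfolding face_dangle_def by (rule DERIV_imp_deriv[OF corner_angle_deriv[OF assms]])

text \<open>The angle at i contributes the terms with cosh l, through
  \<open>angle_deriv_apex\<close>. The other two angles contribute the -1, after symmetry turns d
  theta_j / du_i into d theta_i / du_j.\<close>

lemma face_area_deriv:
  assumes f: "f \<in> F" "i \<in> f" and u: "\<And>v. u v < 0"
  shows "((\<lambda>x. face_area \<Phi> (u(i := x)) f) has_real_derivative
    (\<Sum>j\<in>f - {i}. face_dangle \<Phi> u f i j * (edge_cosh \<Phi> u i j - 1))) (at (u i))"
proof -
  obtain j k where eq: "f = {i, j, k}" and d: "i \<noteq> j" "i \<noteq> k" "j \<noteq> k"
    using face_corner[OF f] .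
  have perm: "{i, j, k} = {i, k, j}" "{i, j, k} = {j, i, k}" "{i, j, k} = {k, i, j}" by auto
  have F: "{i, j, k} \<in> F" "{i, k, j} \<in> F" "{j, i, k} \<in> F" "{k, i, j} \<in> F"
    using f(1) eq perm by simp_all
  have T: "circle_packing_triangle \<Phi> i j k" "circle_packing_triangle \<Phi> i k j"
    using triangle F d by auto
  have dj: "face_dangle \<Phi> u f i j = tri_dangle \<Phi> u i j k"
    unfolding eq by (rule face_dangle_eq) (use F d u in auto)
  have dk: "face_dangle \<Phi> u f i k = tri_dangle \<Phi> u i k j"
    unfolding eq perm(1) by (rule face_dangle_eq) (use F d u in auto)
  have 1: "((\<lambda>x. corner_angle \<Phi> (u(i := x)) i f) has_real_derivative
      - (tri_dangle \<Phi> u i j k * edge_cosh \<Phi> u i j + tri_dangle \<Phi> u i k j * edge_cosh \<Phi> u i k)) (at (u i))"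
    unfolding eq corner_angle_triangle[OF F(1) d]
    by (rule circle_packing_triangle.angle_deriv_apex[OF T(1)]) (rule u)+
  have 2: "((\<lambda>x. corner_angle \<Phi> (u(i := x)) j f) has_real_derivative tri_dangle \<Phi> u i j k) (at (u i))"
    unfolding eq perm(2) circle_packing_triangle.tri_dangle_commute[OF T(1)]
    by (rule corner_angle_deriv) (use F d u in auto)
  have 3: "((\<lambda>x. corner_angle \<Phi> (u(i := x)) k f) has_real_derivative tri_dangle \<Phi> u i k j) (at (u i))"
    unfolding eq perm(3) circle_packing_triangle.tri_dangle_commute[OF T(2)]
    by (rule corner_angle_deriv) (use F d u in auto)
  have area: "face_area \<Phi> w f = pi - (corner_angle \<Phi> w i f + corner_angle \<Phi> w j f + corner_angle \<Phi> w k f)" for w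
    unfolding face_area_def using d eq by simp
  have "f - {i} = {j, k}" using d eq by auto
  then have sum: "(\<Sum>j\<in>f - {i}. face_dangle \<Phi> u f i j * (edge_cosh \<Phi> u i j - 1))
      = 0 - (- (tri_dangle \<Phi> u i j k * edge_cosh \<Phi> u i j + tri_dangle \<Phi> u i k j * edge_cosh \<Phi> u i k)
         + tri_dangle \<Phi> u i j k + tri_dangle \<Phi> u i k j)"
    using d dj dk by (simp add: algebra_simps)
  show ?thesis
    unfolding area sum by (intro DERIV_diff DERIV_add DERIV_const 1 2 3)
qed

text \<open>Exchanging the sums over faces at i and over their other vertices collects, for each
  edge, the faces that make up \<open>Bcoef\<close>.\<close>

lemma Acoef_eq:
  assumes u: "\<And>v. u v < 0"
  shows "Acoef F \<Phi> u i = (\<Sum>j\<in>{j. adjacent F i j}. Bcoef F \<Phi> u i j * (edge_cosh \<Phi> u i j - 1))"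
proof -
  let ?g = "\<lambda>f j. face_dangle \<Phi> u f i j * (edge_cosh \<Phi> u i j - 1)"
  have "Acoef F \<Phi> u i = (\<Sum>f\<in>{f\<in>F. i \<in> f}. \<Sum>j\<in>f - {i}. ?g f j)"
    unfolding Acoef_def by (intro DERIV_imp_deriv DERIV_sum face_area_deriv) (use u in auto)
  also have "\<dots> = (\<Sum>f\<in>{f\<in>F. i \<in> f}. \<Sum>j\<in>{j \<in> {j. adjacent F i j}. j \<in> f}. ?g f j)"
    by (intro sum.cong) (auto simp: adjacent_iff)
  also have "\<dots> = (\<Sum>j\<in>{j. adjacent F i j}. \<Sum>f\<in>{f \<in> {f\<in>F. i \<in> f}. j \<in> f}. ?g f j)"
    by (rule sum.swap_restrict) auto
  also have "\<dots> = (\<Sum>j\<in>{j. adjacent F i j}. Bcoef F \<Phi> u i j * (edge_cosh \<Phi> u i j - 1))"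
    unfolding Bcoef_eq by (simp add: sum_distrib_right conj_assoc)
  finally show ?thesis .
qed

lemma face_dangle_nonneg:
  assumes "f \<in> F" "i \<in> f" "j \<in> f" "i \<noteq> j" and u: "\<And>v. u v < 0"
  shows "0 \<le> face_dangle \<Phi> u f i j"
proof -
  obtain k where f: "f = {i, j, k}" "i \<noteq> k" "j \<noteq> k" using face_vertices[OF assms(1-4)] .
  show ?thesis
    unfolding f(1)
    by (subst face_dangle_eq)
      (use assms f circle_packing_triangle.tri_dangle_nonneg[OF triangle[of i j k], of u] in auto)
qed

lemma Bcoef_nonneg:
  assumes "i \<noteq> j" "\<And>v. u v < 0"
  shows "0 \<le> Bcoef F \<Phi> u i j"
  unfolding Bcoef_eq using assms by (intro sum_nonneg face_dangle_nonneg) auto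

lemma Bcoef_bounded:
  assumes M: "M < 0"
  shows "\<exists>K\<ge>0. \<forall>u i j. (\<forall>v. u v \<le> M) \<longrightarrow> i \<noteq> j \<longrightarrow> Bcoef F \<Phi> u i j \<le> K"
proof -
  have "\<exists>K\<ge>0. \<forall>u. (\<forall>v. u v \<le> M) \<longrightarrow> face_dangle \<Phi> u f i j \<le> K"
    if f: "f \<in> F" "i \<in> f" "j \<in> f" "i \<noteq> j" for f i j
  proof -
    obtain k where k: "f = {i, j, k}" "i \<noteq> k" "j \<noteq> k" using face_vertices[OF f] .
    have t: "circle_packing_triangle \<Phi> i j k" using triangle f k by auto
    obtain K where K: "K \<ge> 0" "\<And>u. u i \<le> M \<Longrightarrow> u j \<le> M \<Longrightarrow> u k \<le> M \<Longrightarrow> tri_dangle \<Phi> u i j k \<le> K"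
      using circle_packing_triangle.tri_dangle_bounded[OF t M] by blast
    have "face_dangle \<Phi> u f i j \<le> K" if u: "\<forall>v. u v \<le> M" for u
    proof -
      have "u v < 0" for v using u M le_less_trans by blast
      then have "face_dangle \<Phi> u f i j = tri_dangle \<Phi> u i j k"
        unfolding k(1) using f k by (intro face_dangle_eq) auto
      then show ?thesis using K(2) u by simp
    qed
    then show ?thesis using K(1) by blast
  qed
  then have "\<exists>K. \<forall>f i j. f \<in> F \<longrightarrow> i \<in> f \<longrightarrow> j \<in> f \<longrightarrow> i \<noteq> j \<longrightarrow>
      K f i j \<ge> 0 \<and> (\<forall>u. (\<forall>v. u v \<le> M) \<longrightarrow> face_dangle \<Phi> u f i j \<le> K f i j)"
    by (intro choice allI) (simp add: Bex_def; metis)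
  then obtain K where K: "\<And>f i j. f \<in> F \<Longrightarrow> i \<in> f \<Longrightarrow> j \<in> f \<Longrightarrow> i \<noteq> j \<Longrightarrow>
      K f i j \<ge> 0 \<and> (\<forall>u. (\<forall>v. u v \<le> M) \<longrightarrow> face_dangle \<Phi> u f i j \<le> K f i j)"
    by blast
  \<comment> \<open>There are finitely many constants, all nonnegative on the index set, so their
    sum dominates every partial sum.\<close>
  define B where "B = (\<Sum>i\<in>UNIV. \<Sum>j\<in>UNIV - {i}. \<Sum>f\<in>{f\<in>F. i \<in> f \<and> j \<in> f}. K f i j)"
  have inner: "0 \<le> (\<Sum>f\<in>{f\<in>F. i \<in> f \<and> j \<in> f}. K f i j)" if "i \<noteq> j" for i j
    using K that by (intro sum_nonneg) auto
  show ?thesis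
  proof (intro exI[of _ B] conjI allI impI)
    show "0 \<le> B" unfolding B_def by (intro sum_nonneg inner) auto
    fix u :: "'v \<Rightarrow> real" and i j :: 'v assume u: "\<forall>v. u v \<le> M" and ij: "i \<noteq> j"
    have "Bcoef F \<Phi> u i j \<le> (\<Sum>f\<in>{f\<in>F. i \<in> f \<and> j \<in> f}. K f i j)"
      unfolding Bcoef_eq using K u ij by (intro sum_mono) auto
    also have "\<dots> \<le> (\<Sum>j\<in>UNIV - {i}. \<Sum>f\<in>{f\<in>F. i \<in> f \<and> j \<in> f}. K f i j)"
      using ij inner by (intro member_le_sum) auto
    also have "\<dots> \<le> B"
      unfolding B_def
      by (rule member_le_sum[of i UNIV "\<lambda>i. \<Sum>j\<in>UNIV - {i}. \<Sum>f\<in>{f\<in>F. i \<in> f \<and> j \<in> f}. K f i j"])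
        (auto intro!: sum_nonneg inner)
    finally show "Bcoef F \<Phi> u i j \<le> B" .
  qed
qed

section \<open>Curvature bounds and vertices carrying a large circle\<close>

lemma corner_angle_range:
  assumes f: "f \<in> F" "i \<in> f" and u: "\<And>v. u v < 0"
  shows "0 \<le> corner_angle \<Phi> u i f" "corner_angle \<Phi> u i f \<le> pi"
proof -
  obtain j k where eq: "f = {i, j, k}" and d: "i \<noteq> j" "i \<noteq> k" "j \<noteq> k"
    using face_corner[OF f] .
  have F: "{i, j, k} \<in> F" using f eq by simp
  note t = triangle[OF F d]
  show "0 \<le> corner_angle \<Phi> u i f" "corner_angle \<Phi> u i f \<le> pi"
    unfolding eq corner_angle_triangle[OF F d]
    using circle_packing_triangle.angle_nonneg[OF t, of u] circle_packing_triangle.angle_le_pi[OF t, of u] u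
    by auto
qed

lemma curvature_le: "(\<And>v. u v < 0) \<Longrightarrow> curvature F \<Phi> u i \<le> 2 * pi"
  unfolding curvature_def by (auto intro!: sum_nonneg corner_angle_range)

lemma curvature_ge:
  assumes "\<And>v. u v < 0"
  shows "2 * pi - real (card F) * pi \<le> curvature F \<Phi> u i"
proof -
  have "(\<Sum>f\<in>{f\<in>F. i \<in> f}. corner_angle \<Phi> u i f) \<le> (\<Sum>f\<in>{f\<in>F. i \<in> f}. pi)"
    using assms by (intro sum_mono corner_angle_range) auto
  also have "\<dots> \<le> real (card F) * pi"
    by (auto intro!: mult_right_mono card_mono)
  finally show ?thesis by (simp add: curvature_def)
qed

lemma weight_gap: "\<exists>d>0. d \<le> 1 \<and> (\<forall>i j. adjacent F i j \<longrightarrow> d \<le> 1 + cos (\<Phi> i j))"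
proof -
  \<comment> \<open>Inserting 1 makes the set nonempty and forces the minimum to be at most
    1.\<close>
  define A where "A = insert 1 ((\<lambda>(i, j). 1 + cos (\<Phi> i j)) ` {(i, j). adjacent F i j})"
  have A: "finite A" "A \<noteq> {}" by (auto simp: A_def)
  have "0 < a" if "a \<in> A" for a
    using that cos_weight_gt unfolding A_def by force
  then have "0 < Min A" using A by simp
  moreover have "Min A \<le> 1" using A by (intro Min_le) (auto simp: A_def)
  moreover have "Min A \<le> 1 + cos (\<Phi> i j)" if "adjacent F i j" for i j
    using A that by (intro Min_le) (auto simp: A_def)
  ultimately show ?thesis by blast
qed

text \<open>The threshold depends only on the triangulation and the weights. Uniformity in the other
  coordinates comes from \<open>angle_small\<close>, whose largeness conditions involve the radius
  at i alone.\<close>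

lemma large_circle:
  "\<exists>c<0. \<forall>u i. (\<forall>v. u v < 0) \<longrightarrow> c \<le> u i \<longrightarrow>
     2 * pi - 1 \<le> curvature F \<Phi> u i \<and> (\<forall>j. adjacent F i j \<longrightarrow> 2 \<le> edge_cosh \<Phi> u i j)"
proof -
  obtain d where d: "0 < d" "d \<le> 1" "\<And>i j. adjacent F i j \<Longrightarrow> d \<le> 1 + cos (\<Phi> i j)"
    using weight_gap by blast
  \<comment> \<open>At most \<open>card F\<close> angles meet at a vertex, so their sum is at most
    1.\<close>
  define \<epsilon> where "\<epsilon> = 1 / (real (card F) + 1)"
  have "\<epsilon> \<le> 1" by (simp add: \<epsilon>_def)
  then have \<epsilon>: "0 < \<epsilon>" "\<epsilon> \<le> pi" using pi_gt3 by (simp add: \<epsilon>_def add_nonneg_pos, linarith)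
  have cos\<epsilon>: "0 < 1 - cos \<epsilon>" using cos_monotone_0_pi[of 0 \<epsilon>] \<epsilon> by simp
  \<comment> \<open>Serves both largeness conditions of \<open>angle_small\<close>; the quadratic
    one follows because X <= X^2 for X >= 2.\<close>
  define R where "R = max 2 (8 / (1 - cos \<epsilon>))"
  have "\<forall>\<^sub>F x in at_left 0. R / d \<le> cosh (radius x)"
    using filterlim_cosh_radius_at_left_0 unfolding filterlim_at_top by blast
  then obtain b where b: "b < 0" "\<And>x. b < x \<Longrightarrow> x < 0 \<Longrightarrow> R / d \<le> cosh (radius x)"
    unfolding eventually_at_left_field by blast
  \<comment> \<open>Halving the negative number \<open>b\<close> turns the strict condition b < u_i
    into the closed one of the statement.\<close>
  have "2 * pi - 1 \<le> curvature F \<Phi> u i \<and> (\<forall>j. adjacent F i j \<longrightarrow> 2 \<le> edge_cosh \<Phi> u i j)"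
    if u: "\<And>v. u v < 0" and ui: "b / 2 \<le> u i" for u i
  proof
    have "R / d \<le> cosh (radius (u i))" using b ui u by auto
    then have RX: "R \<le> d * cosh (radius (u i))" using d by (simp add: pos_divide_le_eq mult.commute)
    then have X: "2 \<le> d * cosh (radius (u i))" by (simp add: R_def)
    have "8 / (1 - cos \<epsilon>) \<le> d * cosh (radius (u i))" using RX by (simp add: R_def)
    also have "\<dots> \<le> (d * cosh (radius (u i)))\<^sup>2"
      using X self_le_power[of "d * cosh (radius (u i))" 2] by simp
    finally have X2: "8 \<le> (1 - cos \<epsilon>) * (d * cosh (radius (u i)))\<^sup>2"
      using cos\<epsilon> by (simp add: pos_divide_le_eq mult.commute)
    have small: "corner_angle \<Phi> u i f \<le> \<epsilon>" if f: "f \<in> F" "i \<in> f" for f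
    proof -
      obtain j k where eq: "f = {i, j, k}" and dist: "i \<noteq> j" "i \<noteq> k" "j \<noteq> k"
        using face_corner[OF f] .
      have F: "{i, j, k} \<in> F" using f eq by simp
      have "adjacent F i j" "adjacent F i k" using F dist by (auto simp: adjacent_iff)
      then show ?thesis
        unfolding eq corner_angle_triangle[OF F dist]
        by (intro circle_packing_triangle.angle_small[OF triangle[OF F dist]])
          (use u d X X2 \<epsilon> in auto)
    qed
    have "(\<Sum>f\<in>{f\<in>F. i \<in> f}. corner_angle \<Phi> u i f) \<le> (\<Sum>f\<in>{f\<in>F. i \<in> f}. \<epsilon>)"
      by (intro sum_mono small) auto
    also have "\<dots> \<le> real (card F) * \<epsilon>"
      using \<epsilon> by (auto intro!: mult_right_mono card_mono)
    also have "\<dots> \<le> 1" by (simp add: \<epsilon>_def)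
    finally show "2 * pi - 1 \<le> curvature F \<Phi> u i" by (simp add: curvature_def)
    show "\<forall>j. adjacent F i j \<longrightarrow> 2 \<le> edge_cosh \<Phi> u i j"
    proof (intro allI impI)
      fix j assume "adjacent F i j"
      then have "d * cosh (radius (u i)) * cosh (radius (u j)) + (1 - d) \<le> edge_cosh \<Phi> u i j"
        using d u by (intro edge_cosh_ge) auto
      moreover have "2 * 1 \<le> d * cosh (radius (u i)) * cosh (radius (u j))"
        using X cosh_real_ge_1 by (intro mult_mono) auto
      ultimately show "2 \<le> edge_cosh \<Phi> u i j" using d by linarith
    qed
  qed
  then show ?thesis using b(1) by (intro exI[of _ "b / 2"]) auto
qed

end

subsection \<open>Long time existence\<close>

text \<open>For p < 2 the factor |s|^(p-2) is singular at 0. The right side has only the positive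
  exponent p - 1, from which continuity is evident; at s = 0 both sides vanish since
  \<open>0 powr x = 0\<close>.\<close>

lemma signed_powr_eq:
  fixes s :: real
  assumes "p > 1"
  shows "\<bar>s\<bar> powr (p - 2) * s = max s 0 powr (p - 1) - max (- s) 0 powr (p - 1)"
proof -
  have eq: "t powr (p - 2) * t = t powr (p - 1)" if "0 < t" for t
    using that powr_add[of t "p - 2" 1] by simp
  show ?thesis
    using eq[of s] eq[of "- s"] by (cases s "0::real" rule: linorder_cases) auto
qed

lemma continuous_on_signed_powr [continuous_intros]:
  fixes f :: "'a::topological_space \<Rightarrow> real"
  assumes "p > 1" "continuous_on T f"
  shows "continuous_on T (\<lambda>w. \<bar>f w\<bar> powr (p - 2) * f w)"
  unfolding signed_powr_eq[OF assms(1)] using assms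
  by (intro continuous_intros continuous_on_powr') auto

lemma signed_powr_le_1:
  fixes s :: real
  assumes "p > 1" "s \<le> 1"
  shows "\<bar>s\<bar> powr (p - 2) * s \<le> 1"
proof -
  have "max s 0 powr (p - 1) \<le> 1" using assms powr_mono2[of "p - 1" "max s 0" 1] by simp
  then show ?thesis
    unfolding signed_powr_eq[OF assms(1)] using powr_ge_zero[of "max (- s) 0" "p - 1"] by linarith
qed

lemma abs_signed_powr_le:
  fixes s :: real
  assumes "p > 1" "\<bar>s\<bar> \<le> L"
  shows "\<bar>\<bar>s\<bar> powr (p - 2) * s\<bar> \<le> L powr (p - 1)"
proof (cases "s = 0")
  case False
  have "\<bar>\<bar>s\<bar> powr (p - 2) * s\<bar> = \<bar>s\<bar> powr (p - 2) * \<bar>s\<bar>" by (simp add: abs_mult)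
  also have "\<dots> = \<bar>s\<bar> powr (p - 1)" using powr_add[of "\<bar>s\<bar>" "p - 2" 1] False by simp
  also have "\<dots> \<le> L powr (p - 1)" using assms by (intro powr_mono2) auto
  finally show ?thesis .
qed simp

lemma continuous_on_cosh_radius:
  assumes "continuous_on T f" "\<And>w. w \<in> T \<Longrightarrow> f w < 0"
  shows "continuous_on T (\<lambda>w. cosh (radius (f w)))" "continuous_on T (\<lambda>w. sinh (radius (f w)))"
proof -
  have "continuous_on {..<0} radius"
    by (rule DERIV_continuous_on[where D = "\<lambda>x. sinh (radius x)"])
      (auto intro!: has_field_derivative_at_within has_real_derivative_radius)
  then have "continuous_on T (\<lambda>w. radius (f w))"
    using assms by (intro continuous_on_compose2[of "{..<0}" radius T f]) auto
  then show "continuous_on T (\<lambda>w. cosh (radius (f w)))" "continuous_on T (\<lambda>w. sinh (radius (f w)))"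
    by (intro continuous_intros; assumption)+
qed

text \<open>A nonstrict sign on the level M alone would not suffice; here it holds throughout h >=
  M, which truncation of the field provides. Beyond the last time at which h <= M, the function is
  nonincreasing and cannot rise.\<close>

lemma barrier_upper:
  fixes h h' :: "real \<Rightarrow> real"
  assumes der: "\<And>t. 0 \<le> t \<Longrightarrow> (h has_real_derivative h' t) (at t within {0..})"
    and start: "h 0 \<le> M" and down: "\<And>t. 0 \<le> t \<Longrightarrow> M \<le> h t \<Longrightarrow> h' t \<le> 0" and "0 \<le> t"
  shows "h t \<le> M"
proof (rule ccontr)
  assume "\<not> h t \<le> M"
  then have t: "M < h t" by simp
  have cont: "continuous_on {0..} h" by (rule DERIV_continuous_on[of _ h h']) (use der in auto)
  define A where "A = {s \<in> {0..t}. h s \<le> M}"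
  have cA: "closed A"
    unfolding A_def by (intro continuous_on_closed_Collect_le continuous_on_subset[OF cont]
        continuous_on_const closed_atLeastAtMost) auto
  have "0 \<in> A" using start \<open>0 \<le> t\<close> by (simp add: A_def)
  then have nA: "A \<noteq> {}" by auto
  have bA: "bdd_above A" by (rule bdd_aboveI[of _ t]) (auto simp: A_def)
  define s where "s = Sup A"
  have "s \<in> A" unfolding s_def by (rule closed_contains_Sup[OF nA bA cA])
  then have s: "0 \<le> s" "s \<le> t" "h s \<le> M" by (auto simp: A_def)
  have above: "M < h r" if r: "s < r" "r < t" for r
  proof (rule ccontr)
    assume "\<not> M < h r"
    then have "r \<in> A" using r s by (auto simp: A_def)
    then have "r \<le> s" unfolding s_def by (rule cSup_upper[OF _ bA])
    then show False using r by simp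
  qed
  have "h t \<le> h s"
  proof (rule DERIV_nonpos_imp_decreasing_open[OF s(2)])
    show "continuous_on {s..t} h" by (rule continuous_on_subset[OF cont]) (use s in auto)
    fix r assume r: "s < r" "r < t"
    have "(h has_real_derivative h' r) (at r)"
      using der[of r] r s at_within_interior[of r "{0..}"] by simp
    moreover have "h' r \<le> 0" using down[of r] above[OF r] r s by simp
    ultimately show "\<exists>y. DERIV h r :> y \<and> y \<le> 0" by blast
  qed
  then show False using t s by simp
qed

text \<open>Phrased for a family \<open>h w\<close> of configurations over any parameter space, so
  that the truncation map can be inserted directly.\<close>

lemma (in circle_packing_triangle)
  fixes h :: "'a::topological_space \<Rightarrow> 'v \<Rightarrow> real"
  assumes cont: "\<And>v. continuous_on T (\<lambda>w. h w v)" and neg: "\<And>w v. w \<in> T \<Longrightarrow> h w v < 0"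
  shows continuous_on_angle: "continuous_on T (\<lambda>w. angle \<Phi> (h w) i j k)"
    and continuous_on_tri_dangle: "continuous_on T (\<lambda>w. tri_dangle \<Phi> (h w) i j k)"
proof -
  have C: "continuous_on T (\<lambda>w. cosh (radius (h w v)))" "continuous_on T (\<lambda>w. sinh (radius (h w v)))" for v
    by (rule continuous_on_cosh_radius[OF cont neg]; assumption)+
  have E: "continuous_on T (\<lambda>w. edge_cosh \<Phi> (h w) a b)" for a b
    unfolding edge_cosh_def by (intro continuous_intros C)
  have nz: "sqrt ((edge_cosh \<Phi> (h w) i j)\<^sup>2 - 1) \<noteq> 0" "sqrt ((edge_cosh \<Phi> (h w) i k)\<^sup>2 - 1) \<noteq> 0"
      "(edge_cosh \<Phi> (h w) i j)\<^sup>2 - 1 \<noteq> 0"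
      "sqrt (gram (edge_cosh \<Phi> (h w) i j) (edge_cosh \<Phi> (h w) i k) (edge_cosh \<Phi> (h w) j k)) \<noteq> 0"
    if "w \<in> T" for w
    using edge_cosh_sq_gt[of "h w"] gram_pos[of "h w"] neg[OF that] by (simp_all add: less_imp_neq)
  have "continuous_on T (\<lambda>w. arccos ((edge_cosh \<Phi> (h w) i j * edge_cosh \<Phi> (h w) i k - edge_cosh \<Phi> (h w) j k)
      / (sqrt ((edge_cosh \<Phi> (h w) i j)\<^sup>2 - 1) * sqrt ((edge_cosh \<Phi> (h w) i k)\<^sup>2 - 1))))"
  proof (rule continuous_on_arccos)
    show "continuous_on T (\<lambda>w. (edge_cosh \<Phi> (h w) i j * edge_cosh \<Phi> (h w) i k - edge_cosh \<Phi> (h w) j k)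
      / (sqrt ((edge_cosh \<Phi> (h w) i j)\<^sup>2 - 1) * sqrt ((edge_cosh \<Phi> (h w) i k)\<^sup>2 - 1)))"
      using nz by (intro continuous_intros E ballI no_zero_divisors) auto
    show "\<forall>w\<in>T. - 1 \<le> (edge_cosh \<Phi> (h w) i j * edge_cosh \<Phi> (h w) i k - edge_cosh \<Phi> (h w) j k)
      / (sqrt ((edge_cosh \<Phi> (h w) i j)\<^sup>2 - 1) * sqrt ((edge_cosh \<Phi> (h w) i k)\<^sup>2 - 1)) \<and>
      (edge_cosh \<Phi> (h w) i j * edge_cosh \<Phi> (h w) i k - edge_cosh \<Phi> (h w) j k)
      / (sqrt ((edge_cosh \<Phi> (h w) i j)\<^sup>2 - 1) * sqrt ((edge_cosh \<Phi> (h w) i k)\<^sup>2 - 1)) \<le> 1"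
    proof
      fix w assume "w \<in> T"
      from cos_law_abs_less_1[of "h w", OF neg[OF this] neg[OF this] neg[OF this]]
      show "- 1 \<le> (edge_cosh \<Phi> (h w) i j * edge_cosh \<Phi> (h w) i k - edge_cosh \<Phi> (h w) j k)
      / (sqrt ((edge_cosh \<Phi> (h w) i j)\<^sup>2 - 1) * sqrt ((edge_cosh \<Phi> (h w) i k)\<^sup>2 - 1)) \<and>
      (edge_cosh \<Phi> (h w) i j * edge_cosh \<Phi> (h w) i k - edge_cosh \<Phi> (h w) j k)
      / (sqrt ((edge_cosh \<Phi> (h w) i j)\<^sup>2 - 1) * sqrt ((edge_cosh \<Phi> (h w) i k)\<^sup>2 - 1)) \<le> 1"
        unfolding abs_less_iff by linarith
    qed
  qed
  then show "continuous_on T (\<lambda>w. angle \<Phi> (h w) i j k)"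
    by (rule continuous_on_eq) (simp add: angle_eq neg)
  show "continuous_on T (\<lambda>w. tri_dangle \<Phi> (h w) i j k)"
    using nz unfolding tri_dangle_def dangle_def dangle_num_def gram_def
    by (intro continuous_intros E C ballI no_zero_divisors) auto
qed

section \<open>Continuity, sign and size of the flow field\<close>

context weighted_triangulation
begin

lemma
  fixes h :: "'a::topological_space \<Rightarrow> 'v \<Rightarrow> real"
  assumes cont: "\<And>v. continuous_on T (\<lambda>w. h w v)" and neg: "\<And>w v. w \<in> T \<Longrightarrow> h w v < 0"
  shows continuous_on_curvature: "continuous_on T (\<lambda>w. curvature F \<Phi> (h w) i)"
    and continuous_on_Bcoef: "i \<noteq> j \<Longrightarrow> continuous_on T (\<lambda>w. Bcoef F \<Phi> (h w) i j)"
proof -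
  have "continuous_on T (\<lambda>w. corner_angle \<Phi> (h w) i f)" if f: "f \<in> F" "i \<in> f" for f
  proof -
    obtain j k where eq: "f = {i, j, k}" and d: "i \<noteq> j" "i \<noteq> k" "j \<noteq> k"
      using face_corner[OF f] .
    have F: "{i, j, k} \<in> F" using f eq by simp
    show ?thesis
      unfolding eq corner_angle_triangle[OF F d]
      by (rule circle_packing_triangle.continuous_on_angle[OF triangle[OF F d] cont neg])
  qed
  then show "continuous_on T (\<lambda>w. curvature F \<Phi> (h w) i)"
    unfolding curvature_def by (intro continuous_intros) auto
  assume ij: "i \<noteq> j"
  have "continuous_on T (\<lambda>w. face_dangle \<Phi> (h w) f i j)" if f: "f \<in> F" "i \<in> f" "j \<in> f" for f
  proof -
    obtain k where k: "f = {i, j, k}" "i \<noteq> k" "j \<noteq> k" using face_vertices[OF f ij] .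
    have F: "{i, j, k} \<in> F" using f k by simp
    have "continuous_on T (\<lambda>w. tri_dangle \<Phi> (h w) i j k)"
      by (rule circle_packing_triangle.continuous_on_tri_dangle[OF triangle[OF F ij k(2,3)] cont neg])
    then show ?thesis
      by (rule continuous_on_eq) (simp add: k(1) face_dangle_eq[OF F ij k(2,3)] neg)
  qed
  then show "continuous_on T (\<lambda>w. Bcoef F \<Phi> (h w) i j)"
    unfolding Bcoef_eq by (intro continuous_intros) auto
qed

lemma continuous_on_calabi_rhs:
  fixes h :: "'a::topological_space \<Rightarrow> 'v \<Rightarrow> real"
  assumes cont: "\<And>v. continuous_on T (\<lambda>w. h w v)" and neg: "\<And>w v. w \<in> T \<Longrightarrow> h w v < 0"
    and "p > 1"
  shows "continuous_on T (\<lambda>w. calabi_rhs F \<Phi> p (h w) i)"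
proof -
  have E: "continuous_on T (\<lambda>w. edge_cosh \<Phi> (h w) i j)" for j
    unfolding edge_cosh_def
    by (intro continuous_intros continuous_on_cosh_radius[OF cont neg])
  \<comment> \<open>\<open>Acoef\<close> is defined by \<open>deriv\<close>, which carries no
    continuity by itself; its expression by \<open>Bcoef\<close> and \<open>edge_cosh\<close> is
    used instead.\<close>
  have "continuous_on T (\<lambda>w. (\<Sum>j\<in>{j. adjacent F i j}.
        Bcoef F \<Phi> (h w) i j * (\<bar>curvature F \<Phi> (h w) j - curvature F \<Phi> (h w) i\<bar> powr (p - 2)
                             * (curvature F \<Phi> (h w) j - curvature F \<Phi> (h w) i)))
     - (\<Sum>j\<in>{j. adjacent F i j}. Bcoef F \<Phi> (h w) i j * (edge_cosh \<Phi> (h w) i j - 1)) * curvature F \<Phi> (h w) i)"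
    using \<open>p > 1\<close> by (intro continuous_on_diff continuous_on_mult continuous_on_sum continuous_on_const
        continuous_on_signed_powr continuous_on_curvature[OF cont neg]
        continuous_on_Bcoef[OF cont neg] E) (auto simp: adjacent_iff)
  then show ?thesis
    by (rule continuous_on_eq) (simp add: calabi_rhs_def Acoef_eq neg)
qed

lemma calabi_rhs_nonpos:
  assumes "p > 1" and u: "\<And>v. u v < 0" and K: "2 * pi - 1 \<le> curvature F \<Phi> u i"
    and long: "\<And>j. adjacent F i j \<Longrightarrow> 2 \<le> edge_cosh \<Phi> u i j"
  shows "calabi_rhs F \<Phi> p u i \<le> 0"
proof -
  let ?K = "curvature F \<Phi> u"
  have "calabi_rhs F \<Phi> p u i = (\<Sum>j\<in>{j. adjacent F i j}.
      Bcoef F \<Phi> u i j * ((\<bar>?K j - ?K i\<bar> powr (p - 2) * (?K j - ?K i)) - (edge_cosh \<Phi> u i j - 1) * ?K i))"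
    unfolding calabi_rhs_def Acoef_eq[OF u] sum_distrib_right sum_subtractf[symmetric]
    by (intro sum.cong refl) (simp add: algebra_simps)
  also have "\<dots> \<le> 0"
  proof (rule sum_nonpos)
    fix j assume "j \<in> {j. adjacent F i j}"
    then have adj: "adjacent F i j" by simp
    have "?K j - ?K i \<le> 1" using curvature_le[of u j] u K by simp
    then have "\<bar>?K j - ?K i\<bar> powr (p - 2) * (?K j - ?K i) \<le> 1"
      by (rule signed_powr_le_1[OF \<open>p > 1\<close>])
    moreover have "1 * 1 \<le> (edge_cosh \<Phi> u i j - 1) * ?K i"
      using long[OF adj] K pi_gt3 by (intro mult_mono) auto
    moreover have "0 \<le> Bcoef F \<Phi> u i j"
      using adj u by (intro Bcoef_nonneg) (auto simp: adjacent_iff)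
    ultimately show "Bcoef F \<Phi> u i j * ((\<bar>?K j - ?K i\<bar> powr (p - 2) * (?K j - ?K i))
        - (edge_cosh \<Phi> u i j - 1) * ?K i) \<le> 0"
      by (intro mult_nonneg_nonpos) auto
  qed
  finally show ?thesis .
qed

lemma calabi_rhs_bounded:
  assumes "p > 1" "M < 0"
  shows "\<exists>R. \<forall>u i. (\<forall>v. u v \<le> M) \<longrightarrow> \<bar>calabi_rhs F \<Phi> p u i\<bar> \<le> R"
proof -
  obtain B where B: "0 \<le> B" "\<And>u i j. (\<forall>v. u v \<le> M) \<Longrightarrow> i \<noteq> j \<Longrightarrow> Bcoef F \<Phi> u i j \<le> B"
    using Bcoef_bounded[OF \<open>M < 0\<close>] by blast
  \<comment> \<open>Curvatures lie between 2 pi - |F| pi and 2 pi, so \<open>L\<close> bounds both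
    their absolute values and their differences.\<close>
  define L where "L = 2 * pi + real (card F) * pi"
  define E where "E = 2 * cosh (radius M) * cosh (radius M)"
  define R where "R = B * L powr (p - 1) + B * E * L"
  have "\<bar>calabi_rhs F \<Phi> p u i\<bar> \<le> real CARD('v) * R" if uM: "\<forall>v. u v \<le> M" for u i
  proof -
    have u: "u v < 0" for v using uM \<open>M < 0\<close> le_less_trans by blast
    let ?K = "curvature F \<Phi> u"
    let ?t = "\<lambda>j. Bcoef F \<Phi> u i j * (\<bar>?K j - ?K i\<bar> powr (p - 2) * (?K j - ?K i))
        - Bcoef F \<Phi> u i j * (edge_cosh \<Phi> u i j - 1) * ?K i"
    have L: "0 \<le> L" by (simp add: L_def)
    have E: "0 \<le> E" by (simp add: E_def)
    have lo: "2 * pi - real (card F) * pi \<le> ?K j" for j by (rule curvature_ge) (rule u)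
    have hi: "?K j \<le> 2 * pi" for j by (rule curvature_le) (rule u)
    have K: "\<bar>?K j\<bar> \<le> L" "\<bar>?K j - ?K i\<bar> \<le> L" for j
      using lo[of j] hi[of j] lo[of i] hi[of i] pi_gt_zero
        mult_nonneg_nonneg[of "real (card F)" pi] unfolding L_def by linarith+
    have t: "\<bar>?t j\<bar> \<le> R" if adj: "adjacent F i j" for j
    proof -
      have ij: "i \<noteq> j" using adj by (simp add: adjacent_iff)
      have b: "\<bar>Bcoef F \<Phi> u i j\<bar> \<le> B" using Bcoef_nonneg[OF ij u] B(2)[OF uM ij] by simp
      have "1 < edge_cosh \<Phi> u i j" using cos_weight_gt[OF adj] u by (intro edge_cosh_gt_1)
      moreover have "edge_cosh \<Phi> u i j \<le> E"
      proof -
        have "edge_cosh \<Phi> u i j \<le> 2 * cosh (radius (u i)) * cosh (radius (u j))"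
          by (rule edge_cosh_le) (rule u)+
        also have "\<dots> \<le> E"
          unfolding E_def using uM \<open>M < 0\<close> by (intro mult_mono cosh_radius_mono) auto
        finally show ?thesis .
      qed
      ultimately have e: "\<bar>edge_cosh \<Phi> u i j - 1\<bar> \<le> E" by simp
      have 1: "\<bar>Bcoef F \<Phi> u i j * (\<bar>?K j - ?K i\<bar> powr (p - 2) * (?K j - ?K i))\<bar> \<le> B * L powr (p - 1)"
        unfolding abs_mult[of "Bcoef F \<Phi> u i j"]
        by (rule mult_mono[OF b abs_signed_powr_le[OF \<open>p > 1\<close> K(2)]]) (use B(1) in auto)
      have "\<bar>Bcoef F \<Phi> u i j * (edge_cosh \<Phi> u i j - 1)\<bar> \<le> B * E"
        unfolding abs_mult by (rule mult_mono[OF b e]) (use B(1) in auto)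
      from mult_mono[OF this K(1)[of i]]
      have 2: "\<bar>Bcoef F \<Phi> u i j * (edge_cosh \<Phi> u i j - 1) * ?K i\<bar> \<le> B * E * L"
        unfolding abs_mult[of _ "?K i"] using B(1) E by simp
      from 1 2 show ?thesis unfolding R_def by linarith
    qed
    have R: "0 \<le> R" using B L E by (simp add: R_def)
    have rhs: "calabi_rhs F \<Phi> p u i = (\<Sum>j\<in>{j. adjacent F i j}. ?t j)"
      unfolding calabi_rhs_def Acoef_eq[OF u] sum_distrib_right
      by (rule sum_subtractf[symmetric])
    have "\<bar>calabi_rhs F \<Phi> p u i\<bar> \<le> (\<Sum>j\<in>{j. adjacent F i j}. \<bar>?t j\<bar>)"
      unfolding rhs by (rule sum_abs)
    also have "\<dots> \<le> (\<Sum>j\<in>{j. adjacent F i j}. R)"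
      by (rule sum_mono) (rule t, simp)
    also have "\<dots> = real (card {j. adjacent F i j}) * R" by simp
    also have "\<dots> \<le> real CARD('v) * R"
      using R by (intro mult_right_mono of_nat_mono card_mono) auto
    finally show ?thesis .
  qed
  then show ?thesis by (intro exI[of _ "real CARD('v) * R"] allI impI)
qed

end

theorem theorem1p3:
  fixes F :: "'v::finite set set" and \<Phi> :: "'v \<Rightarrow> 'v \<Rightarrow> real"
    and p :: real and r0 :: "'v \<Rightarrow> real"
  assumes "closed_surface_triangulation F"
    and "weight F \<Phi>"
    and "star_condition F \<Phi>"
    and "p > 1"
    and "\<forall>i. r0 i > 0"
  shows "\<exists>u :: real \<Rightarrow> 'v \<Rightarrow> real.
           u 0 = (\<lambda>i. ln (tanh (r0 i / 2))) \<and>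
           (\<forall>t\<ge>0. \<forall>i. u t i < 0) \<and>
           (\<forall>t\<ge>0. \<forall>i. ((\<lambda>s. u s i) has_real_derivative calabi_rhs F \<Phi> p (u t) i)
                          (at t within {0..}))"
proof -
  interpret weighted_triangulation F \<Phi> by unfold_locales (use assms in auto)
  define u0 where "u0 i = ln (tanh (r0 i / 2))" for i
  have u0: "u0 i < 0" for i
  proof -
    have "0 < tanh (r0 i / 2)" "tanh (r0 i / 2) < 1" using assms(5) tanh_real_lt_1 by auto
    then show ?thesis unfolding u0_def by simp
  qed
  obtain c where c: "c < 0" "\<And>u i. (\<And>v. u v < 0) \<Longrightarrow> c \<le> u i \<Longrightarrow>
     2 * pi - 1 \<le> curvature F \<Phi> u i \<and> (\<forall>j. adjacent F i j \<longrightarrow> 2 \<le> edge_cosh \<Phi> u i j)"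
    using large_circle by blast
  \<comment> \<open>Above all initial values, so the flow starts below the barrier, and at least
    \<open>c\<close>, so that \<open>large_circle\<close> applies at the barrier.\<close>
  define M where "M = Max (insert c (range u0))"
  have M: "M < 0" "c \<le> M" using c(1) u0 by (simp_all add: M_def)
  have u0M: "u0 i \<le> M" for i unfolding M_def by (rule Max_ge) auto
  \<comment> \<open>The flow is truncated at \<open>u \<le> M\<close>; the barrier shows that the truncation is never felt.\<close>
  define h where "h w v = min (w $ v) M" for w :: "real ^ 'v" and v
  have h: "h w v < 0" "h w v \<le> M" for w v using M by (auto simp: h_def)
  define g where "g w = (\<chi> i. calabi_rhs F \<Phi> p (h w) i)" for w :: "real ^ 'v"
  have "continuous_on UNIV (\<lambda>w. h w v)" for v
    unfolding h_def by (intro continuous_intros)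
  from continuous_on_calabi_rhs[OF this h(1) assms(4)] have "continuous_on UNIV g"
    unfolding g_def by (intro continuous_on_vec_lambda)
  moreover have "bounded (range g)"
  proof -
    obtain R where R: "\<And>u i. (\<forall>v. u v \<le> M) \<Longrightarrow> \<bar>calabi_rhs F \<Phi> p u i\<bar> \<le> R"
      using calabi_rhs_bounded[OF assms(4) M(1)] by blast
    have "norm (g w) \<le> real CARD('v) * R" for w
    proof -
      have "norm (g w) \<le> (\<Sum>i\<in>UNIV. \<bar>g w $ i\<bar>)" by (rule norm_le_l1_cart)
      also have "\<dots> \<le> (\<Sum>i\<in>(UNIV::'v set). R)" unfolding g_def using R h by (intro sum_mono) auto
      finally show ?thesis by simp
    qed
    then show ?thesis unfolding bounded_iff by blast
  qed
  ultimately obtain x where x0: "x 0 = (\<chi> i. u0 i)"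
    and x: "\<And>t. 0 \<le> t \<Longrightarrow> (x has_vector_derivative g (x t)) (at t within {0..})"
    using peano_global[of g "\<chi> i. u0 i"] by blast
  have der: "((\<lambda>s. x s $ i) has_real_derivative calabi_rhs F \<Phi> p (h (x t)) i) (at t within {0..})"
    if "0 \<le> t" for t i
  proof -
    have "((\<lambda>s. x s $ i) has_vector_derivative g (x t) $ i) (at t within {0..})"
      by (rule bounded_linear.has_vector_derivative[OF bounded_linear_vec_nth x[OF that]])
    then show ?thesis by (simp add: g_def has_real_derivative_iff_has_vector_derivative)
  qed
  have le: "x t $ i \<le> M" if "0 \<le> t" for t i
  proof (rule barrier_upper[OF der _ _ that])
    show "x 0 $ i \<le> M" using u0M by (simp add: x0)
    fix s assume "0 \<le> s" "M \<le> x s $ i"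
    \<comment> \<open>Above the barrier the truncated coordinate equals \<open>M\<close>; about the
      remaining coordinates only negativity is used.\<close>
    then have "c \<le> h (x s) i" using M by (simp add: h_def)
    then show "calabi_rhs F \<Phi> p (h (x s)) i \<le> 0"
      using c(2)[of "h (x s)" i] h by (intro calabi_rhs_nonpos assms(4)) auto
  qed
  have hx: "h (x t) = ($) (x t)" if "0 \<le> t" for t
    using le[OF that] by (auto simp: h_def)
  show ?thesis
  proof (intro exI[of _ "\<lambda>t. ($) (x t)"] conjI allI impI)
    show "($) (x 0) = (\<lambda>i. ln (tanh (r0 i / 2)))" by (auto simp: x0 u0_def)
    show "x t $ i < 0" if "0 \<le> t" for t i using le[OF that, of i] M by simp
    show "((\<lambda>s. x s $ i) has_real_derivative calabi_rhs F \<Phi> p (($) (x t)) i) (at t within {0..})"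
      if "0 \<le> t" for t i using der[OF that, of i] hx[OF that] by simp
  qed
qed

end
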